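(* Let $K$ be an infinite stable field with the property that for every (small) subset $B\subseteq K$ and all $x,y\in K$ that are non-generic over $B$, both $x+y$ and $x\cdot y$ are non-generic over $B$. Let $\mathbb{F}_p$ denote the prime subfield of $K$. Let $A\subseteq K$ be a (small) subset, $m\geq 1$, and $g,h_1,\dots,h_m\in K$. Suppose $g$ is generic over $A$ and $g$ is separably algebraic (in the field-theoretic sense) over the field $\mathbb{F}_p(A,h_1,\dots,h_m)$. Then $h_i$ is generic over $A$ for some $i\in\{1,\dots,m\}$.
   Context: A stable field is a field $K$ considered as a first-order structure, endowed with its field operations and possibly additional relations, such that $\mathrm{Th}(K)$ is stable. By convention $K$ is a monster model (very saturated model) of its theory, and sets of parameters are small, i.e. of cardinality less than the degree of saturation. Generics: a definable subset $X$ of a stable group $G$ is generic if finitely many translates of $X$ cover $G$; a complete type over a set $A$ is generic if every formula in it defines a generic set; an element $g$ is generic over $A$ if $\mathrm{tp}(g/A)$ is generic, and non-generic over $A$ otherwise. An infinite stable field has a unique generic type (over each set of parameters), which is the generic type both of the additive and of the multiplicative group. Here $p$ is the characteristic of $K$ and $\mathbb{F}_p$ denotes the prime subfield of $K$ (so it is $\mathbb{Q}$ when the characteristic is $0$). $\mathbb{F}_p(A,h_1,\dots,h_m)$ is the subfield of $K$ generated by $A\cup\{h_1,\dots,h_m\}$. An element is separably algebraic over a subfield if it is a root of a separable polynomial over that subfield. *)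

theory Defs
  imports "HOL-Computational_Algebra.Polynomial"
begin

unbundle cardinal_syntax

section \<open>Fields with additional relations as first-order structures\<close>

text \<open>
  A field is a type of class \<open>field\<close>. The language is the language of rings together with
  relation symbols from \<open>'r\<close>, interpreted by \<open>I :: 'r \<Rightarrow> 'a list \<Rightarrow> bool\<close>. No arities are declared:
  applied to \<open>n\<close> arguments, the symbol \<open>r\<close> serves as an \<open>n\<close>-ary relation symbol. A language
  with arities is the special case in which \<open>I r\<close> is false on all lists of the wrong length;
  this gives the same definable sets.
\<close>

datatype trm = Var nat | Zero | One | Neg trm | Add trm trm | Mul trm trm

datatype 'r fm =
    Eq trm trm
  | Rel 'r "trm list"
  | Not "'r fm"
  | And "'r fm" "'r fm"
  | Ex nat "'r fm"

primrec fv_trm :: "trm \<Rightarrow> nat set" where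
  "fv_trm (Var i) = {i}"
| "fv_trm Zero = {}"
| "fv_trm One = {}"
| "fv_trm (Neg s) = fv_trm s"
| "fv_trm (Add s t) = fv_trm s \<union> fv_trm t"
| "fv_trm (Mul s t) = fv_trm s \<union> fv_trm t"

primrec fv :: "'r fm \<Rightarrow> nat set" where
  "fv (Eq s t) = fv_trm s \<union> fv_trm t"
| "fv (Rel r ts) = (\<Union>t\<in>set ts. fv_trm t)"
| "fv (Not \<phi>) = fv \<phi>"
| "fv (And \<phi> \<psi>) = fv \<phi> \<union> fv \<psi>"
| "fv (Ex i \<phi>) = fv \<phi> - {i}"

primrec eval_trm :: "(nat \<Rightarrow> 'a::field) \<Rightarrow> trm \<Rightarrow> 'a" where
  "eval_trm e (Var i) = e i"
| "eval_trm e Zero = 0"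
| "eval_trm e One = 1"
| "eval_trm e (Neg s) = - eval_trm e s"
| "eval_trm e (Add s t) = eval_trm e s + eval_trm e t"
| "eval_trm e (Mul s t) = eval_trm e s * eval_trm e t"

primrec sat :: "('r \<Rightarrow> 'a::field list \<Rightarrow> bool) \<Rightarrow> (nat \<Rightarrow> 'a) \<Rightarrow> 'r fm \<Rightarrow> bool" where
  "sat I e (Eq s t) \<longleftrightarrow> eval_trm e s = eval_trm e t"
| "sat I e (Rel r ts) \<longleftrightarrow> I r (map (eval_trm e) ts)"
| "sat I e (Not \<phi>) \<longleftrightarrow> \<not> sat I e \<phi>"
| "sat I e (And \<phi> \<psi>) \<longleftrightarrow> sat I e \<phi> \<and> sat I e \<psi>"
| "sat I e (Ex i \<phi>) \<longleftrightarrow> (\<exists>x. sat I (e(i := x)) \<phi>)"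

section \<open>Formulas with parameters, types, saturation\<close>

text \<open>
  A formula over \<open>A\<close> in one variable is a formula \<open>\<phi>\<close> in the variable \<open>0\<close> together with a
  valuation \<open>e\<close> whose values at the other free variables of \<open>\<phi>\<close> are the parameters.
\<close>

definition formulas_over :: "'a set \<Rightarrow> ('r fm \<times> (nat \<Rightarrow> 'a)) set" where
  "formulas_over A = {(\<phi>, e). \<forall>i \<in> fv \<phi> - {0}. e i \<in> A}"

definition defset ::
    "('r \<Rightarrow> 'a::field list \<Rightarrow> bool) \<Rightarrow> 'r fm \<times> (nat \<Rightarrow> 'a) \<Rightarrow> 'a set" where
  "defset I = (\<lambda>(\<phi>, e). {x. sat I (e(0 := x)) \<phi>})"

definition tp ::
    "('r \<Rightarrow> 'a::field list \<Rightarrow> bool) \<Rightarrow> 'a set \<Rightarrow> 'a \<Rightarrow> ('r fm \<times> (nat \<Rightarrow> 'a)) set" where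
  "tp I A g = {\<psi> \<in> formulas_over A. g \<in> defset I \<psi>}"

definition small :: "'k rel \<Rightarrow> 'a set \<Rightarrow> bool" where
  "small \<kappa> A \<longleftrightarrow> |A| <o \<kappa>"

definition saturated :: "'k rel \<Rightarrow> ('r \<Rightarrow> 'a::field list \<Rightarrow> bool) \<Rightarrow> bool" where
  "saturated \<kappa> I \<longleftrightarrow>
    (\<forall>A \<Phi>. small \<kappa> A \<longrightarrow> \<Phi> \<subseteq> formulas_over A \<longrightarrow>
      (\<forall>\<Phi>\<^sub>0 \<subseteq> \<Phi>. finite \<Phi>\<^sub>0 \<longrightarrow> (\<exists>x. \<forall>\<psi>\<in>\<Phi>\<^sub>0. x \<in> defset I \<psi>)) \<longrightarrow>
      (\<exists>x. \<forall>\<psi>\<in>\<Phi>. x \<in> defset I \<psi>))"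

text \<open>
  The degree of saturation \<open>\<kappa>\<close> is a cardinal above the number of formulas, that is, above the
  size of the language and \<open>\<aleph>\<^sub>0\<close>. Strong homogeneity is not demanded.
\<close>

definition monster :: "'k rel \<Rightarrow> ('r \<Rightarrow> 'a::field list \<Rightarrow> bool) \<Rightarrow> bool" where
  "monster \<kappa> I \<longleftrightarrow> Card_order \<kappa> \<and> |UNIV :: 'r fm set| <o \<kappa> \<and> saturated \<kappa> I"

section \<open>Stability\<close>

text \<open>
  The set \<open>V\<close> partitions the variables of \<open>\<phi>\<close> as \<open>\<phi>(x;y)\<close>: variables in \<open>V\<close> belong to the
  tuple \<open>x\<close> and are read from \<open>a i\<close>, all others belong to \<open>y\<close> and are read from \<open>b j\<close>.
\<close>

definition has_ladder ::
    "('r \<Rightarrow> 'a::field list \<Rightarrow> bool) \<Rightarrow> 'r fm \<Rightarrow> nat set \<Rightarrow> nat \<Rightarrow> bool" where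
  "has_ladder I \<phi> V n \<longleftrightarrow>
    (\<exists>a b :: nat \<Rightarrow> nat \<Rightarrow> 'a. \<forall>i<n. \<forall>j<n. sat I (override_on (b j) (a i) V) \<phi> \<longleftrightarrow> i < j)"

text \<open>
  The theory of the structure is stable if no partitioned formula has the order property.
  Existence of an \<open>n\<close>-ladder is expressed by a first-order sentence, so this depends only on the
  theory; by compactness, ladders of all finite lengths amount to an infinite ladder in some model
  of the theory.
\<close>

definition stable_theory :: "('r \<Rightarrow> 'a::field list \<Rightarrow> bool) \<Rightarrow> bool" where
  "stable_theory I \<longleftrightarrow> (\<forall>\<phi> V. \<not> (\<forall>n. has_ladder I \<phi> V n))"

section \<open>Generics\<close>

text \<open>
  Genericity is taken in the additive group. In an infinite stable field the additive and the
  multiplicative generic types coincide.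
\<close>

definition generic_set :: "'a::ab_group_add set \<Rightarrow> bool" where
  "generic_set X \<longleftrightarrow> (\<exists>F. finite F \<and> (\<Union>a\<in>F. (+) a ` X) = UNIV)"

definition generic_over :: "('r \<Rightarrow> 'a::field list \<Rightarrow> bool) \<Rightarrow> 'a set \<Rightarrow> 'a \<Rightarrow> bool" where
  "generic_over I A g \<longleftrightarrow> (\<forall>\<psi> \<in> tp I A g. generic_set (defset I \<psi>))"

section \<open>Generated subfields and separable algebraicity\<close>

definition is_subfield :: "'a::field set \<Rightarrow> bool" where
  "is_subfield L \<longleftrightarrow> 0 \<in> L \<and> 1 \<in> L \<and> (\<forall>x\<in>L. - x \<in> L \<and> inverse x \<in> L) \<and>
    (\<forall>x\<in>L. \<forall>y\<in>L. x + y \<in> L \<and> x * y \<in> L)"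

text \<open>
  The subfield generated by \<open>S\<close>; it contains the prime subfield, as every subfield does.
\<close>

definition subfield_gen :: "'a::field set \<Rightarrow> 'a set" where
  "subfield_gen S = \<Inter>{L. is_subfield L \<and> S \<subseteq> L}"

text \<open>
  A polynomial is separable (no repeated roots in an algebraic closure) if it is coprime to its
  derivative. Coprimality does not depend on the field over which it is considered.
\<close>

definition separable :: "'a::field poly \<Rightarrow> bool" where
  "separable f \<longleftrightarrow> coprime f (pderiv f)"

definition separably_algebraic_over :: "'a::field \<Rightarrow> 'a set \<Rightarrow> bool" where
  "separably_algebraic_over g L \<longleftrightarrow>
    (\<exists>f. (\<forall>i. coeff f i \<in> L) \<and> separable f \<and> poly f g = 0)"

end

theory Submission
  imports Defs
begin

text \<open>
  The elements that are non-generic over \<open>B\<close> form a subfield \<open>N B\<close> of the field \<open>K\<close>, and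
  \<open>N B \<noteq> K\<close> for small \<open>B\<close>. If the theorem fails, then the generic \<open>g\<close> is a simple root of a
  polynomial over \<open>N A\<close>; as the generic type over \<open>A\<close> is unique, every element of \<open>K\<close> is a
  simple root of a polynomial over \<open>N A\<close> of bounded degree. Choose \<open>B\<close> for which the bound is
  least, \<open>g \<notin> N B\<close>, and \<open>x\<close> generic over \<open>B \<union> {g}\<close>. Then \<open>x\<close>, \<open>x + g\<close> and \<open>x * g\<close> have
  minimal polynomials of the same degree over \<open>N B\<close>, and that of \<open>x\<close> does not change over
  \<open>N (B \<union> {g})\<close>. Comparing coefficients shows that it has derivative zero, so \<open>x\<close> is not a simple root.
\<close>

section \<open>Definable sets\<close>

text \<open>Genericity is defined additively and only through covering by translates, so two facts
  about stable fields have to be earned from the absence of ladders: that the generic type is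
  unique, and that the inverse of a non-generic element is non-generic, which closure under sums and
  products does not give. The bound on the degree is minimised over all small parameter sets at
  once, not for \<open>A\<close> alone. A minimum attached to one set could drop as soon as
  \<open>g\<close> is added to the parameters, while the argument needs one degree that is minimal
  before and after this addition.\<close>

primrec ren_trm :: "(nat \<Rightarrow> nat) \<Rightarrow> trm \<Rightarrow> trm" where
  "ren_trm \<rho> (Var i) = Var (\<rho> i)"
| "ren_trm \<rho> Zero = Zero"
| "ren_trm \<rho> One = One"
| "ren_trm \<rho> (Neg s) = Neg (ren_trm \<rho> s)"
| "ren_trm \<rho> (Add s t) = Add (ren_trm \<rho> s) (ren_trm \<rho> t)"
| "ren_trm \<rho> (Mul s t) = Mul (ren_trm \<rho> s) (ren_trm \<rho> t)"

text \<open>Bound variables are renamed along with the free ones. Injectivity of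
  \<open>\<rho>\<close> excludes capture, which is why \<open>sat_ren\<close> and
  \<open>fv_ren\<close> ask for it.\<close>

primrec ren :: "(nat \<Rightarrow> nat) \<Rightarrow> 'r fm \<Rightarrow> 'r fm" where
  "ren \<rho> (Eq s t) = Eq (ren_trm \<rho> s) (ren_trm \<rho> t)"
| "ren \<rho> (Rel r ts) = Rel r (map (ren_trm \<rho>) ts)"
| "ren \<rho> (Not \<phi>) = Not (ren \<rho> \<phi>)"
| "ren \<rho> (And \<phi> \<psi>) = And (ren \<rho> \<phi>) (ren \<rho> \<psi>)"
| "ren \<rho> (Ex i \<phi>) = Ex (\<rho> i) (ren \<rho> \<phi>)"

lemma eval_ren_trm: "eval_trm e (ren_trm \<rho> t) = eval_trm (e \<circ> \<rho>) t"
  by (induction t) auto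

lemma fv_ren_trm: "fv_trm (ren_trm \<rho> t) = \<rho> ` fv_trm t"
  by (induction t) auto

lemma sat_ren: "inj \<rho> \<Longrightarrow> sat I e (ren \<rho> \<phi>) \<longleftrightarrow> sat I (e \<circ> \<rho>) \<phi>"
proof (induction \<phi> arbitrary: e)
  case (Rel r ts)
  then show ?case by (simp add: eval_ren_trm comp_def cong: map_cong)
next
  case (Ex i \<phi>)
  have "e(\<rho> i := x) \<circ> \<rho> = (e \<circ> \<rho>)(i := x)" for x
    using Ex.prems by (auto simp: fun_eq_iff inj_eq)
  then show ?case using Ex by (simp del: o_apply fun_upd_apply comp_apply)
qed (auto simp: eval_ren_trm)

lemma fv_ren: "inj \<rho> \<Longrightarrow> fv (ren \<rho> \<phi>) = \<rho> ` fv \<phi>"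
  by (induction \<phi>) (auto simp: fv_ren_trm inj_eq)

lemma eval_trm_cong: "(\<And>i. i \<in> fv_trm t \<Longrightarrow> e i = e' i) \<Longrightarrow> eval_trm e t = eval_trm e' t"
  by (induction t) auto

lemma sat_cong: "(\<And>i. i \<in> fv \<phi> \<Longrightarrow> e i = e' i) \<Longrightarrow> sat I e \<phi> \<longleftrightarrow> sat I e' \<phi>"
proof (induction \<phi> arbitrary: e e')
  case (Eq s t)
  then show ?case using eval_trm_cong[of s e e'] eval_trm_cong[of t e e'] by simp
next
  case (Rel r ts)
  then have "map (eval_trm e) ts = map (eval_trm e') ts"
    by (auto intro!: eval_trm_cong)
  then show ?case by (simp only: sat.simps)
next
  case (And \<phi> \<psi>)
  have "sat I e \<phi> \<longleftrightarrow> sat I e' \<phi>" by (rule And.IH(1)) (use And.prems in auto)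
  moreover have "sat I e \<psi> \<longleftrightarrow> sat I e' \<psi>" by (rule And.IH(2)) (use And.prems in auto)
  ultimately show ?case by simp
next
  case (Ex i \<phi>)
  have "sat I (e(i := x)) \<phi> \<longleftrightarrow> sat I (e'(i := x)) \<phi>" for x
    by (rule Ex.IH) (use Ex.prems in auto)
  then show ?case by simp
next
  case (Not \<phi>)
  have "sat I e \<phi> \<longleftrightarrow> sat I e' \<phi>" by (rule Not.IH) (use Not.prems in auto)
  then show ?case by simp
qed

lemma finite_fv_trm: "finite (fv_trm t)"
  by (induction t) auto

lemma finite_fv: "finite (fv \<phi>)"
  by (induction \<phi>) (auto simp: finite_fv_trm)

lemma sat_foldr_Ex:
  "sat I e (foldr Ex is \<phi>) \<longleftrightarrow> (\<exists>w. sat I (override_on e w (set is)) \<phi>)"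
proof (induction "is" arbitrary: e)
  case (Cons i "is")
  have 1: "override_on (e(i := x)) w (set is) =
      override_on e (if i \<in> set is then w else w(i := x)) (set (i # is))" for x w
    by (auto simp: override_on_def fun_eq_iff)
  have 2: "override_on e w (set (i # is)) = override_on (e(i := w i)) w (set is)" for w
    by (auto simp: override_on_def fun_eq_iff)
  have "(\<exists>x w. sat I (override_on (e(i := x)) w (set is)) \<phi>) \<longleftrightarrow>
      (\<exists>w. sat I (override_on e w (set (i # is))) \<phi>)" (is "?l \<longleftrightarrow> ?r")
  proof
    assume ?l
    then show ?r using 1 by (elim exE) (simp only:, rule exI)
  next
    assume ?r
    then show ?l using 2 by (elim exE) (simp only:, intro exI)
  qed
  then show ?case by (simp only: foldr.simps comp_apply sat.simps Cons.IH)
qed simp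

lemma fv_foldr_Ex: "fv (foldr Ex is \<phi>) = fv \<phi> - set is"
  by (induction "is") auto

section \<open>Sets and predicates definable with parameters\<close>

definition definable_over ::
    "('r \<Rightarrow> 'a::field list \<Rightarrow> bool) \<Rightarrow> 'a set \<Rightarrow> 'a set set" where
  "definable_over I B = defset I ` formulas_over B"

text \<open>
  For predicates on valuations, the even variables of the formula stand for the arguments and the
  odd ones for the parameters, so that both supplies are infinite.
\<close>

definition mix :: "(nat \<Rightarrow> 'a) \<Rightarrow> (nat \<Rightarrow> 'a) \<Rightarrow> nat \<Rightarrow> 'a" where
  "mix v e i = (if even i then v (i div 2) else e (i div 2))"

definition definable_pred ::
    "('r \<Rightarrow> 'a::field list \<Rightarrow> bool) \<Rightarrow> 'a set \<Rightarrow> ((nat \<Rightarrow> 'a) \<Rightarrow> bool) \<Rightarrow> bool" where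
  "definable_pred I B P \<longleftrightarrow>
    (\<exists>\<phi> e. (\<forall>i\<in>fv \<phi>. odd i \<longrightarrow> e (i div 2) \<in> B) \<and> (\<forall>v. P v \<longleftrightarrow> sat I (mix v e) \<phi>))"

lemma mix_simps [simp]: "mix v e (2 * i) = v i" "mix v e (Suc (2 * i)) = e i" "mix v e 0 = v 0"
  by (auto simp: mix_def)

lemma definable_pred_not:
  assumes "definable_pred I B P" shows "definable_pred I B (\<lambda>v. \<not> P v)"
proof -
  obtain \<phi> e where "\<forall>i\<in>fv \<phi>. odd i \<longrightarrow> e (i div 2) \<in> B" "\<forall>v. P v \<longleftrightarrow> sat I (mix v e) \<phi>"
    using assms unfolding definable_pred_def by blast
  then show ?thesis unfolding definable_pred_def
    by (intro exI[of _ "Not \<phi>"] exI[of _ e]) auto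
qed

lemma definable_pred_conj:
  assumes "definable_pred I B P" "definable_pred I B Q"
  shows "definable_pred I B (\<lambda>v. P v \<and> Q v)"
proof -
  obtain \<phi> e where \<phi>: "\<forall>i\<in>fv \<phi>. odd i \<longrightarrow> e (i div 2) \<in> B" "\<forall>v. P v \<longleftrightarrow> sat I (mix v e) \<phi>"
    using assms unfolding definable_pred_def by blast
  obtain \<psi> f where \<psi>: "\<forall>i\<in>fv \<psi>. odd i \<longrightarrow> f (i div 2) \<in> B" "\<forall>v. Q v \<longleftrightarrow> sat I (mix v f) \<psi>"
    using assms unfolding definable_pred_def by blast
  \<comment> \<open>Arguments stay fixed. The parameters of the two formulas go to the even and the
    odd places of the sequence \<open>mix e f\<close>, so they cannot clash.\<close>
  define r where "r i = (if even i then i else Suc (2 * (2 * (i div 2))))" for i :: nat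
  define s where "s i = (if even i then i else Suc (2 * Suc (2 * (i div 2))))" for i :: nat
  have r: "inj r" and s: "inj s"
    by (auto simp: inj_def r_def s_def elim!: evenE oddE split: if_splits; presburger)+
  have "mix v (mix e f) \<circ> r = mix v e" "mix v (mix e f) \<circ> s = mix v f" for v
    by (auto simp: fun_eq_iff r_def s_def mix_def elim!: oddE)
  then have "P v \<and> Q v \<longleftrightarrow> sat I (mix v (mix e f)) (And (ren r \<phi>) (ren s \<psi>))" for v
    using \<phi>(2) \<psi>(2) by (simp add: sat_ren r s)
  moreover have "mix e f (i div 2) \<in> B" if "i \<in> r ` fv \<phi>" "odd i" for i
    using that \<phi>(1) by (auto simp: r_def elim!: oddE split: if_splits)
  moreover have "mix e f (i div 2) \<in> B" if "i \<in> s ` fv \<psi>" "odd i" for i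
    using that \<psi>(1) by (auto simp: s_def elim!: oddE split: if_splits)
  ultimately show ?thesis unfolding definable_pred_def
    by (intro exI[of _ "And (ren r \<phi>) (ren s \<psi>)"] exI[of _ "mix e f"]) (auto simp: fv_ren r s)
qed

lemma definable_pred_ex:
  assumes "definable_pred I B P" shows "definable_pred I B (\<lambda>v. \<exists>x. P (v(i := x)))"
proof -
  obtain \<phi> e where \<phi>: "\<forall>i\<in>fv \<phi>. odd i \<longrightarrow> e (i div 2) \<in> B" "\<forall>v. P v \<longleftrightarrow> sat I (mix v e) \<phi>"
    using assms unfolding definable_pred_def by blast
  have "mix (v(i := x)) e = (mix v e)(2 * i := x)" for v x
    by (auto simp: fun_eq_iff mix_def elim!: evenE)
  with \<phi> show ?thesis unfolding definable_pred_def
    by (intro exI[of _ "Ex (2 * i) \<phi>"] exI[of _ e]) auto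
qed

lemma definable_pred_eq:
  fixes I :: "'r \<Rightarrow> 'a::field list \<Rightarrow> bool"
  shows "definable_pred I B (\<lambda>v. eval_trm v s = eval_trm v t)"
proof -
  have "mix v e \<circ> (*) 2 = v" for v e :: "nat \<Rightarrow> 'a" by auto
  then show ?thesis unfolding definable_pred_def
    by (intro exI[of _ "Eq (ren_trm ((*) 2) s) (ren_trm ((*) 2) t)"] exI[of _ "\<lambda>_. 0"])
      (auto simp: eval_ren_trm fv_ren_trm)
qed

lemma definable_pred_const:
  assumes "a \<in> B" shows "definable_pred I B (\<lambda>v. v i = a)"
  unfolding definable_pred_def
  by (intro exI[of _ "Eq (Var (2 * i)) (Var 1)"] exI[of _ "\<lambda>_. a"])
    (use assms in \<open>auto simp: mix_def\<close>)

lemma definable_pred_rename: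
  assumes "definable_pred I B P" "inj \<rho>" shows "definable_pred I B (\<lambda>v. P (v \<circ> \<rho>))"
proof -
  obtain \<phi> e where \<phi>: "\<forall>i\<in>fv \<phi>. odd i \<longrightarrow> e (i div 2) \<in> B" "\<forall>v. P v \<longleftrightarrow> sat I (mix v e) \<phi>"
    using assms unfolding definable_pred_def by blast
  define r where "r i = (if even i then 2 * \<rho> (i div 2) else i)" for i
  have r: "inj r"
  proof (rule injI)
    fix i j assume "r i = r j"
    then have "i = j \<or> even i \<and> even j \<and> \<rho> (i div 2) = \<rho> (j div 2)"
      by (auto simp: r_def split: if_splits)
    then show "i = j"
      using injD[OF assms(2)] by (metis dvd_mult_div_cancel)
  qed
  have "mix v e \<circ> r = mix (v \<circ> \<rho>) e" for v
    by (auto simp: fun_eq_iff mix_def r_def)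
  with \<phi> show ?thesis unfolding definable_pred_def
    by (intro exI[of _ "ren r \<phi>"] exI[of _ e])
      (auto simp: sat_ren fv_ren r, auto simp: r_def split: if_splits)
qed

lemma definable_over_iff: "X \<in> definable_over I B \<longleftrightarrow> definable_pred I B (\<lambda>v. v 0 \<in> X)"
proof
  assume "X \<in> definable_over I B"
  then obtain \<phi> e where \<phi>: "(\<phi>, e) \<in> formulas_over B" and X: "X = {x. sat I (e(0 := x)) \<phi>}"
    unfolding definable_over_def by (auto simp: defset_def)
  define r where "r i = (if i = 0 then 0 else Suc (2 * i))" for i :: nat
  have r: "inj r" by (auto simp: inj_def r_def split: if_splits)
  have "mix v e \<circ> r = e(0 := v 0)" for v
    by (auto simp: fun_eq_iff r_def)
  then show "definable_pred I B (\<lambda>v. v 0 \<in> X)"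
    using \<phi> unfolding definable_pred_def X
    by (intro exI[of _ "ren r \<phi>"] exI[of _ e])
      (auto simp: sat_ren fv_ren r formulas_over_def, auto simp: r_def split: if_splits)
next
  assume "definable_pred I B (\<lambda>v. v 0 \<in> X)"
  then obtain \<phi> e where \<phi>: "\<forall>i\<in>fv \<phi>. odd i \<longrightarrow> e (i div 2) \<in> B"
      "\<forall>v. v 0 \<in> X \<longleftrightarrow> sat I (mix v e) \<phi>"
    unfolding definable_pred_def by blast
  \<comment> \<open>Arguments other than the first may occur freely in \<open>\<phi>\<close>; they are quantified away, as \<open>B\<close>
    need not contain values for them.\<close>
  have fin: "finite {i \<in> fv \<phi>. even i \<and> i \<noteq> 0}"
    by (rule finite_subset[OF _ finite_fv[of \<phi>]]) blast
  obtain "is" where "is": "set is = {i \<in> fv \<phi>. even i \<and> i \<noteq> 0}"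
    using finite_list[OF fin] by (elim exE)
  \<comment> \<open>Only the values at odd variables matter: variable 0 is overwritten by
    \<open>x\<close>, and the other even variables of the formula are bound by the quantifiers in
    \<open>is\<close>.\<close>
  define f where "f i = e (i div 2)" for i
  have "sat I (f(0 := x)) (foldr Ex is \<phi>) \<longleftrightarrow> x \<in> X" for x
  proof -
    have "sat I (override_on (f(0 := x)) w (set is)) \<phi> \<longleftrightarrow> x \<in> X" for w
    proof -
      define v where "v i = (if i = 0 then x else w (2 * i))" for i
      have "sat I (override_on (f(0 := x)) w (set is)) \<phi> \<longleftrightarrow> sat I (mix v e) \<phi>"
      proof (rule sat_cong)
        fix i assume "i \<in> fv \<phi>"
        then show "override_on (f(0 := x)) w (set is) i = mix v e i"
          by (cases "even i"; cases "i = 0")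
            (auto simp: override_on_def mix_def f_def v_def "is" elim!: evenE)
      qed
      also have "\<dots> \<longleftrightarrow> v 0 \<in> X" by (rule \<phi>(2)[rule_format, symmetric])
      finally show ?thesis by (simp add: v_def)
    qed
    then show ?thesis by (simp add: sat_foldr_Ex)
  qed
  then have "X = defset I (foldr Ex is \<phi>, f)"
    by (auto simp: defset_def)
  moreover have "(foldr Ex is \<phi>, f) \<in> formulas_over B"
    using \<phi>(1) "is" by (auto simp: formulas_over_def fv_foldr_Ex f_def)
  ultimately show "X \<in> definable_over I B"
    unfolding definable_over_def by blast
qed

lemma definable_pred_mem:
  assumes "X \<in> definable_over I B" shows "definable_pred I B (\<lambda>v. v i \<in> X)"
proof -
  have "inj (id(0 := i, i := 0))" by (auto simp: inj_def split: if_splits)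
  from definable_pred_rename[OF assms[unfolded definable_over_iff] this] show ?thesis
    by (auto simp: comp_def split: if_splits)
qed

section \<open>Closure properties of definable sets\<close>

lemma definable_over_mono: "B \<subseteq> C \<Longrightarrow> X \<in> definable_over I B \<Longrightarrow> X \<in> definable_over I C"
  by (fastforce simp: definable_over_def formulas_over_def)

lemma definable_over_Compl: "X \<in> definable_over I B \<Longrightarrow> - X \<in> definable_over I B"
  unfolding definable_over_iff by (auto dest: definable_pred_not)

lemma definable_over_Int:
  "X \<in> definable_over I B \<Longrightarrow> Y \<in> definable_over I B \<Longrightarrow> X \<inter> Y \<in> definable_over I B"
  unfolding definable_over_iff by (auto dest: definable_pred_conj)

lemma definable_over_Un:
  assumes "X \<in> definable_over I B" "Y \<in> definable_over I B" shows "X \<union> Y \<in> definable_over I B"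
proof -
  have "- (- X \<inter> - Y) \<in> definable_over I B"
    using assms by (intro definable_over_Compl definable_over_Int)
  then show ?thesis by simp
qed

lemma definable_over_Diff:
  "X \<in> definable_over I B \<Longrightarrow> Y \<in> definable_over I B \<Longrightarrow> X - Y \<in> definable_over I B"
  by (simp add: Diff_eq definable_over_Int definable_over_Compl)

lemma definable_over_UNIV: "UNIV \<in> definable_over I B"
  using definable_pred_eq[of I B Zero Zero] by (simp add: definable_over_iff)

lemma definable_over_empty: "{} \<in> definable_over I B"
  using definable_over_Compl[OF definable_over_UNIV[of I B]] by simp

lemma definable_over_UN:
  assumes "finite F" "\<And>f. f \<in> F \<Longrightarrow> X f \<in> definable_over I B"
  shows "(\<Union>f\<in>F. X f) \<in> definable_over I B"
  using assms by (induction F) (auto intro: definable_over_Un definable_over_empty)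

lemma definable_over_affine_image:
  assumes "X \<in> definable_over I UNIV" shows "(\<lambda>x. a * x + b) ` X \<in> definable_over I UNIV"
proof -
  \<comment> \<open>Terms have no names for \<open>a\<close> and \<open>b\<close>, so two variables
    are pinned to them and quantified away together with the preimage \<open>v 3\<close>.\<close>
  have "definable_pred I UNIV (\<lambda>v. (v 3 \<in> X \<and> v 1 = a) \<and> v 2 = b \<and>
      eval_trm v (Var 0) = eval_trm v (Add (Mul (Var 1) (Var 3)) (Var 2)))"
    by (intro definable_pred_conj definable_pred_mem definable_pred_const definable_pred_eq assms) auto
  from definable_pred_ex[OF definable_pred_ex[OF definable_pred_ex[OF this, of 3], of 2], of 1]
  show ?thesis unfolding definable_over_iff
    by (rule back_subst[where P = "definable_pred I UNIV"]) (auto simp: fun_eq_iff)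
qed

text \<open>\<open>has_ladder\<close> admits no separate parameters; those of \<open>P\<close> are
  absorbed into the second tuple \<open>mix (b j) e\<close>. One infinite ladder provides ladders of
  every finite length.\<close>

lemma stable_no_ladder:
  assumes "stable_theory I" "definable_pred I UNIV P"
    "\<And>i j. P (\<lambda>k. if k = 0 then a i else b j k) \<longleftrightarrow> i < (j::nat)"
  shows False
proof -
  obtain \<phi> e where \<phi>: "\<forall>v. P v \<longleftrightarrow> sat I (mix v e) \<phi>"
    using assms unfolding definable_pred_def by blast
  have "override_on (mix (b j) e) (\<lambda>_. a i) {0} = mix (\<lambda>k. if k = 0 then a i else b j k) e" for i j
    by (auto simp: fun_eq_iff override_on_def mix_def elim!: evenE)
  then have "has_ladder I \<phi> {0} n" for n
    unfolding has_ladder_def using \<phi> assms(3)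
    by (intro exI[of _ "\<lambda>i (_::nat). a i"] exI[of _ "\<lambda>j. mix (b j) e"]) simp
  then show False using assms(1) unfolding stable_theory_def by blast
qed

section \<open>Ladders\<close>

lemma dependent_choice_history:
  fixes Q :: "'b set \<Rightarrow> 'b \<Rightarrow> bool"
  assumes "\<And>F. finite F \<Longrightarrow> (\<And>x. x \<in> F \<Longrightarrow> S x) \<Longrightarrow> \<exists>y. S y \<and> Q F y"
  obtains f :: "nat \<Rightarrow> 'b" where "\<And>n. S (f n)" "\<And>n. Q (f ` {..<n}) (f n)"
proof -
  have "\<exists>f :: nat \<Rightarrow> 'b. \<forall>n. S (f n) \<and> Q (f ` {..<n}) (f n)"
  proof (rule dependent_wf_choice[OF wf_less])
    fix f g :: "nat \<Rightarrow> 'b" and n :: nat and r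
    assume "\<And>m. (m, n) \<in> {(x, y). x < y} \<Longrightarrow> f m = g m"
    then have "f ` {..<n} = g ` {..<n}" by (intro image_cong) auto
    then show "(S r \<and> Q (f ` {..<n}) r) = (S r \<and> Q (g ` {..<n}) r)" by simp
  next
    fix n :: nat and f :: "nat \<Rightarrow> 'b"
    assume "\<And>m. (m, n) \<in> {(x, y). x < y} \<Longrightarrow> S (f m) \<and> Q (f ` {..<m}) (f m)"
    then show "\<exists>r. S r \<and> Q (f ` {..<n}) r"
      by (intro assms) auto
  qed
  then show ?thesis using that by blast
qed

lemma ladder_of_extension:
  assumes "\<And>F. finite F \<Longrightarrow> \<exists>b. \<forall>a\<in>F. R a b"
    and "\<And>F. finite F \<Longrightarrow> \<exists>a. \<forall>b\<in>F. \<not> R a b"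
  obtains a :: "nat \<Rightarrow> 'b" and b :: "nat \<Rightarrow> 'c" where "\<And>i j. R (a i) (b j) \<longleftrightarrow> i < j"
proof -
  define Q where "Q F y \<longleftrightarrow> (\<forall>x\<in>F. R (fst x) (snd y) \<and> \<not> R (fst y) (snd x)) \<and>
      \<not> R (fst y) (snd y)" for F :: "('b \<times> 'c) set" and y
  have "\<exists>y. True \<and> Q F y" if fin: "finite F" for F
  proof -
    \<comment> \<open>Choosing \<open>b\<close> first lets \<open>a\<close> avoid it as well; this
      settles the diagonal, where a ladder is false.\<close>
    obtain b where b: "\<forall>a\<in>fst ` F. R a b" using assms(1)[of "fst ` F"] fin by auto
    obtain a where a: "\<forall>b\<in>insert b (snd ` F). \<not> R a b"
      using assms(2)[of "insert b (snd ` F)"] fin by auto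
    from a b have "Q F (a, b)" by (auto simp: Q_def)
    then show ?thesis by blast
  qed
  then obtain f :: "nat \<Rightarrow> 'b \<times> 'c" where f: "\<And>n. Q (f ` {..<n}) (f n)"
    using dependent_choice_history[of "\<lambda>_. True" Q] by metis
  have "R (fst (f i)) (snd (f j)) \<longleftrightarrow> i < j" for i j
    using f[of i] f[of j] by (cases i j rule: linorder_cases) (auto simp: Q_def)
  then show ?thesis using that[of "\<lambda>i. fst (f i)" "\<lambda>j. snd (f j)"] by blast
qed

text \<open>
  A splitting of every member of \<open>\<G>\<close> gives full binary trees. The ladder is read off along a
  branch: a point \<open>x\<close> of \<open>Z\<close> partitions the available sets into those containing \<open>x\<close> and
  those not containing \<open>x\<close>, and one of the two parts is still available below some \<open>Z' \<subseteq> Z\<close>.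
\<close>

lemma ladder_of_splitting:
  fixes Y :: "'b \<Rightarrow> 'a set"
  assumes "Z0 \<in> \<G>" and ne: "\<And>Z. Z \<in> \<G> \<Longrightarrow> Z \<noteq> {}"
    and split: "\<And>Z. Z \<in> \<G> \<Longrightarrow> \<exists>y. Z \<inter> Y y \<in> \<G> \<and> Z - Y y \<in> \<G>"
    and mono: "\<And>Z Z' y. Z \<in> \<G> \<Longrightarrow> Z' \<in> \<G> \<Longrightarrow> Z' \<subseteq> Z \<Longrightarrow> Z' \<inter> Y y \<in> \<G> \<Longrightarrow> Z' - Y y \<in> \<G> \<Longrightarrow>
        Z \<inter> Y y \<in> \<G> \<and> Z - Y y \<in> \<G>"
  obtains t and a :: "nat \<Rightarrow> 'a" and b where "\<And>i j. (a i \<in> Y (b j) \<longleftrightarrow> t) \<longleftrightarrow> i < j"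
proof -
  define splits where "splits y Z \<longleftrightarrow> Z \<inter> Y y \<in> \<G> \<and> Z - Y y \<in> \<G>" for y Z
  define dense where "dense B Z \<longleftrightarrow> Z \<in> \<G> \<and> (\<forall>Z'\<in>\<G>. Z' \<subseteq> Z \<longrightarrow> (\<exists>y\<in>B. splits y Z'))" for B Z
  have step: "\<exists>B' Z' x t y. dense B' Z' \<and> B' \<subseteq> B \<and> Z' \<subseteq> Z \<and> x \<in> Z \<and> y \<in> B \<and>
      (x \<in> Y y \<longleftrightarrow> t) \<and> (\<forall>z\<in>Z'. z \<in> Y y \<longleftrightarrow> \<not> t) \<and> (\<forall>y'\<in>B'. x \<in> Y y' \<longleftrightarrow> t)"
    if Z: "dense B Z" for B Z
  proof -
    obtain x where x: "x \<in> Z" using Z ne by (auto simp: dense_def)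
    obtain B' Z1 t where B': "B' = {y \<in> B. x \<in> Y y \<longleftrightarrow> t}" "dense B' Z1" "Z1 \<subseteq> Z"
    proof (cases "dense {y \<in> B. x \<in> Y y \<longleftrightarrow> True} Z")
      \<comment> \<open>Some \<open>Z1\<close> is split by no index in \<open>B\<close> whose set
        contains \<open>x\<close>. By \<open>mono\<close> the same holds for every available set
        below \<open>Z1\<close>, so the indices whose sets miss \<open>x\<close> suffice
        there.\<close>
      case False
      with Z obtain Z1 where Z1: "Z1 \<in> \<G>" "Z1 \<subseteq> Z"
        "\<And>y. y \<in> B \<Longrightarrow> x \<in> Y y \<Longrightarrow> \<not> splits y Z1"
        by (auto simp: dense_def)
      have "dense {y \<in> B. x \<in> Y y \<longleftrightarrow> False} Z1"
        unfolding dense_def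
      proof (intro conjI ballI impI)
        fix Z' assume Z': "Z' \<in> \<G>" "Z' \<subseteq> Z1"
        then obtain y where y: "y \<in> B" "splits y Z'"
          using Z Z1(2) unfolding dense_def by blast
        then have "splits y Z1" using mono[OF Z1(1) Z'] by (simp add: splits_def)
        then show "\<exists>y\<in>{y \<in> B. x \<in> Y y \<longleftrightarrow> False}. splits y Z'" using y Z1(3) by blast
      qed (fact Z1)
      then show ?thesis using Z1 that by blast
    qed blast
    from B'(2) obtain y where y: "y \<in> B'" "splits y Z1" unfolding dense_def by blast
    \<comment> \<open>The next stage lies on the side of \<open>Y y\<close> opposite to
      \<open>x\<close>, so all later points disagree with \<open>x\<close> about
      \<open>y\<close>.\<close>
    define Z' where "Z' = (if t then Z1 - Y y else Z1 \<inter> Y y)"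
    have "dense B' Z'"
      using B'(2) y(2) unfolding dense_def splits_def Z'_def by (auto split: if_splits)
    then show ?thesis
      using B' y x by (intro exI[of _ B'] exI[of _ Z'] exI[of _ x] exI[of _ t] exI[of _ y])
        (auto simp: Z'_def split: if_splits)
  qed
  define next' where "next' s s' x t y \<longleftrightarrow> fst s' \<subseteq> fst s \<and> snd s' \<subseteq> snd s \<and> x \<in> snd s \<and>
      y \<in> fst s \<and> (x \<in> Y y \<longleftrightarrow> t) \<and> (\<forall>z\<in>snd s'. z \<in> Y y \<longleftrightarrow> \<not> t) \<and> (\<forall>y'\<in>fst s'. x \<in> Y y' \<longleftrightarrow> t)"
    for s s' :: "'b set \<times> 'a set" and x t y
  have "\<exists>s :: nat \<Rightarrow> 'b set \<times> 'a set. \<forall>n. dense (fst (s n)) (snd (s n)) \<and>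
      (\<exists>x t y. next' (s n) (s (Suc n)) x t y)"
  proof (rule dependent_nat_choice)
    show "\<exists>s. dense (fst s) (snd s)"
      using assms(1) split by (intro exI[of _ "(UNIV, Z0)"]) (auto simp: dense_def splits_def)
    show "\<exists>s'. dense (fst s') (snd s') \<and> (\<exists>x t y. next' s s' x t y)" if s: "dense (fst s) (snd s)" for s
    proof -
      obtain B' Z' x t y where "dense B' Z'" "next' s (B', Z') x t y"
        using step[OF s] unfolding next'_def by auto
      then show ?thesis by (intro exI[of _ "(B', Z')"]) auto
    qed
  qed
  then obtain s where "\<And>n. \<exists>x t y. next' (s n) (s (Suc n)) x t y" by blast
  then obtain x t y where s: "\<And>n. next' (s n) (s (Suc n)) (x n) (t n) (y n)" by metis
  have anti: "fst (s j) \<subseteq> fst (s i)" "snd (s j) \<subseteq> snd (s i)" if "i \<le> j" for i j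
  proof -
    have "fst (s (Suc n)) \<subseteq> fst (s n)" "snd (s (Suc n)) \<subseteq> snd (s n)" for n
      using s[of n] by (simp_all add: next'_def)
    then show "fst (s j) \<subseteq> fst (s i)" "snd (s j) \<subseteq> snd (s i)"
      using that lift_Suc_antimono_le[of "\<lambda>i. fst (s i)"] lift_Suc_antimono_le[of "\<lambda>i. snd (s i)"]
      by blast+
  qed
  have up: "x i \<in> Y (y j) \<longleftrightarrow> t i" if "i \<le> j" for i j
  proof (cases "i = j")
    case False
    then have "y j \<in> fst (s (Suc i))" using that s[of j] anti(1)[of "Suc i" j] by (auto simp: next'_def)
    then show ?thesis using s[of i] by (auto simp: next'_def)
  qed (use s in \<open>auto simp: next'_def\<close>)
  have down: "x i \<in> Y (y j) \<longleftrightarrow> \<not> t j" if "j < i" for i j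
  proof -
    have "x i \<in> snd (s (Suc j))" using that s[of i] anti(2)[of "Suc j" i] by (auto simp: next'_def)
    then show ?thesis using s[of j] by (auto simp: next'_def)
  qed
  \<comment> \<open>The truth value \<open>t n\<close> may change from stage to stage; one of the
    two values occurs infinitely often.\<close>
  obtain t0 where "infinite {n. t n = t0}"
  proof (cases "finite {n. t n = True}")
    case True
    have "{n. t n = True} \<union> {n. t n = False} = UNIV" by auto
    with True have "infinite {n. t n = False}" by (metis finite_Un infinite_UNIV_nat)
    then show ?thesis using that by blast
  qed (use that in blast)
  then obtain r :: "nat \<Rightarrow> nat" where r: "strict_mono r" "\<And>n. t (r n) = t0"
    by (metis (mono_tags, lifting) infinite_enumerate mem_Collect_eq)
  \<comment> \<open>\<open>up\<close> covers i \<le> j. Shifting the points by one turns this into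
    the strict inequality of a ladder.\<close>
  have "(x (r (Suc i)) \<in> Y (y (r j)) \<longleftrightarrow> t0) \<longleftrightarrow> i < j" for i j
    using up[of "r (Suc i)" "r j"] down[of "r j" "r (Suc i)"] r
    by (cases "i < j") (auto simp: strict_mono_less_eq strict_mono_less Suc_le_eq)
  then show ?thesis using that[of "\<lambda>i. x (r (Suc i))" "\<lambda>j. y (r j)" t0] by blast
qed

section \<open>Uniqueness of the generic type\<close>

lemma generic_set_iff:
  "generic_set X \<longleftrightarrow> (\<exists>F. finite F \<and> (\<forall>x. \<exists>a\<in>F. x - a \<in> X))"
proof -
  have "x \<in> (+) a ` X \<longleftrightarrow> x - a \<in> X" for x a
    by (auto intro!: image_eqI[of _ _ "x - a"])
  then have "(\<Union>a\<in>F. (+) a ` X) = UNIV \<longleftrightarrow> (\<forall>x. \<exists>a\<in>F. x - a \<in> X)" for F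
    by (simp only: set_eq_iff UN_iff UNIV_I simp_thms)
  then show ?thesis by (simp only: generic_set_def)
qed

lemma generic_set_mono:
  assumes "generic_set X" "X \<subseteq> Y" shows "generic_set Y"
proof -
  obtain F where F: "finite F" "\<forall>x. \<exists>a\<in>F. x - a \<in> X" using assms(1) by (auto simp: generic_set_iff)
  show ?thesis unfolding generic_set_iff using F assms(2) by (intro exI[of _ F]) fast
qed

lemma not_generic_setD: "\<not> generic_set X \<Longrightarrow> finite F \<Longrightarrow> \<exists>x. \<forall>a\<in>F. x - a \<notin> X"
  by (auto simp: generic_set_iff)

lemma generic_set_nonempty: "generic_set X \<Longrightarrow> X \<noteq> {}"
  by (auto simp: generic_set_iff)

lemma generic_set_UNIV: "generic_set UNIV"
  unfolding generic_set_iff by (intro exI[of _ "{0}"]) auto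

lemma generic_set_affine_image:
  fixes a :: "'a::field"
  assumes "a \<noteq> 0" shows "generic_set ((\<lambda>x. a * x + b) ` X) \<longleftrightarrow> generic_set X"
proof -
  have *: "generic_set ((\<lambda>x. a * x + b) ` X)" if X: "generic_set X" and "a \<noteq> 0" for a b :: 'a and X
  proof -
    obtain F where F: "finite F" "\<And>x. \<exists>f\<in>F. x - f \<in> X" using X by (auto simp only: generic_set_iff)
    have "\<exists>f\<in>(*) a ` F. x - f \<in> (\<lambda>x. a * x + b) ` X" for x
    proof -
      obtain f where "f \<in> F" "(x - b) / a - f \<in> X" using F by blast
      moreover have "x - a * f = a * ((x - b) / a - f) + b" using \<open>a \<noteq> 0\<close> by (simp add: field_simps)
      ultimately show ?thesis by blast
    qed
    then show ?thesis unfolding generic_set_iff using F(1) by (intro exI[of _ "(*) a ` F"]) simp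
  qed
  have "(\<lambda>x. inverse a * x + - b / a) ` (\<lambda>x. a * x + b) ` X = X"
    using assms by (auto simp: image_image field_simps)
  then show ?thesis using *[of X a b] *[of "(\<lambda>x. a * x + b) ` X" "inverse a" "- b / a"] assms by auto
qed

section \<open>The ideal of non-generic definable sets\<close>

locale infinite_stable_field =
  fixes I :: "'r \<Rightarrow> 'a::field list \<Rightarrow> bool"
  assumes infinite_field: "infinite (UNIV :: 'a set)"
    and stable: "stable_theory I"
begin

abbreviation definable :: "'a set \<Rightarrow> bool" where
  "definable X \<equiv> X \<in> definable_over I UNIV"

lemma no_ladder:
  assumes "definable_pred I UNIV (\<lambda>v. R (v 0) (v 1))" "\<And>i j. R (a i) (b j) \<longleftrightarrow> i < (j::nat)"
  shows False
  using stable_no_ladder[OF stable assms(1), of a "\<lambda>j _. b j"] assms(2) by simp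

text \<open>Otherwise the relation b - a \<in> X extends in both directions: finitely many
  translates of \<open>- X\<close> do not cover, which gives b for finitely many a, and finitely
  many translates of \<open>X\<close> do not cover, which gives a for finitely many b.\<close>

lemma generic_or_Compl_generic:
  assumes "definable X" shows "generic_set X \<or> generic_set (- X)"
proof (rule ccontr)
  assume neg: "\<not> (generic_set X \<or> generic_set (- X))"
  have "\<exists>b. \<forall>a\<in>F. b - a \<in> X" if "finite F" for F
    using not_generic_setD[of "- X" F] neg that by auto
  moreover have "\<exists>a. \<forall>b\<in>F. \<not> b - a \<in> X" if "finite F" for F
  proof -
    obtain c where "\<forall>f\<in>uminus ` F. c - f \<notin> X"
      using not_generic_setD[of X "uminus ` F"] neg \<open>finite F\<close> by blast
    then show ?thesis by (intro exI[of _ "- c"]) (simp add: add.commute)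
  qed
  ultimately obtain a b :: "nat \<Rightarrow> 'a" where ab: "\<And>i j. b j - a i \<in> X \<longleftrightarrow> i < j"
    using ladder_of_extension[of "\<lambda>a b. b - a \<in> X"] by metis
  have "definable_pred I UNIV (\<lambda>v. v 2 \<in> X \<and>
      eval_trm v (Var 1) = eval_trm v (Add (Var 0) (Var 2)))"
    by (intro definable_pred_conj definable_pred_mem definable_pred_eq assms)
  from definable_pred_ex[OF this, of 2]
  have "definable_pred I UNIV (\<lambda>v. \<exists>z. z \<in> X \<and> v 1 = v 0 + z)" by simp
  also have "(\<lambda>v :: nat \<Rightarrow> 'a. \<exists>z. z \<in> X \<and> v 1 = v 0 + z) = (\<lambda>v. v 1 - v 0 \<in> X)"
  proof (rule ext)
    fix v :: "nat \<Rightarrow> 'a"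
    have "v 1 = v 0 + (v 1 - v 0)" by simp
    then show "(\<exists>z. z \<in> X \<and> v 1 = v 0 + z) \<longleftrightarrow> v 1 - v 0 \<in> X"
      by (metis add_diff_cancel_left')
  qed
  finally show False using no_ladder[of "\<lambda>x y. y - x \<in> X" a b] ab by simp
qed

text \<open>If the translates of \<open>X \<union> Y\<close> by \<open>F\<close> cover, then so do
  those of \<open>X\<close> together with those of \<open>Y\<close>. By the dichotomy one of these
  two finite unions is generic, and a finite union of translates of a set is generic only if the set
  is.\<close>

lemma nongeneric_Un:
  assumes "definable X" "definable Y" "\<not> generic_set X" "\<not> generic_set Y"
  shows "\<not> generic_set (X \<union> Y)"
proof
  assume "generic_set (X \<union> Y)"
  then obtain F where F: "finite F" "\<And>x. \<exists>f\<in>F. x - f \<in> X \<union> Y" by (auto simp only: generic_set_iff)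
  define U where "U Z = (\<Union>f\<in>F. (\<lambda>x. 1 * x + f) ` Z)" for Z
  have def_U: "definable (U X)"
    unfolding U_def using F(1) assms by (intro definable_over_UN definable_over_affine_image)
  have gen_U: "generic_set Z" if Z: "generic_set (U Z)" for Z
  proof -
    obtain G where G: "finite G" "\<And>x. \<exists>g\<in>G. x - g \<in> U Z" using Z by (auto simp only: generic_set_iff)
    have "\<exists>h\<in>(\<lambda>(g, f). g + f) ` (G \<times> F). x - h \<in> Z" for x
    proof -
      obtain g f z where "g \<in> G" "f \<in> F" "z \<in> Z" "x - g = z + f"
        using G(2)[of x] unfolding U_def by auto
      then show ?thesis by (intro bexI[of _ "g + f"] image_eqI[of _ _ "(g, f)"]) (auto simp: algebra_simps)
    qed
    then show ?thesis unfolding generic_set_iff using G(1) F(1)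
      by (intro exI[of _ "(\<lambda>(g, f). g + f) ` (G \<times> F)"]) simp
  qed
  have "- U X \<subseteq> U Y"
  proof
    fix x assume "x \<in> - U X"
    moreover obtain f where "f \<in> F" "x - f \<in> X \<union> Y" using F(2) by blast
    moreover have "x \<in> U Z" if "x - f \<in> Z" "f \<in> F" for Z
      unfolding U_def using that by (auto intro!: bexI[of _ f] image_eqI[of _ _ "x - f"])
    ultimately show "x \<in> U Y" by blast
  qed
  then show False
    using generic_or_Compl_generic[OF def_U] gen_U assms(3,4) generic_set_mono by blast
qed

lemma nongeneric_UN:
  assumes "finite F" "\<And>f. f \<in> F \<Longrightarrow> definable (X f)" "\<And>f. f \<in> F \<Longrightarrow> \<not> generic_set (X f)"
  shows "\<not> generic_set (\<Union>f\<in>F. X f)"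
  using assms
proof (induction F)
  case empty
  then show ?case using generic_set_nonempty by auto
next
  case (insert f F)
  then show ?case by (simp add: nongeneric_Un definable_over_UN)
qed

lemma nongeneric_UN_neq_UNIV:
  assumes "finite F" "\<And>f. f \<in> F \<Longrightarrow> definable (X f)" "\<And>f. f \<in> F \<Longrightarrow> \<not> generic_set (X f)"
  shows "\<exists>x. \<forall>f\<in>F. x \<notin> X f"
proof (rule ccontr)
  assume "\<not> ?thesis"
  then have "(\<Union>f\<in>F. X f) = UNIV" by auto
  moreover have "\<not> generic_set (\<Union>f\<in>F. X f)" by (rule nongeneric_UN) (use assms in auto)
  ultimately show False by (simp add: generic_set_UNIV)
qed

section \<open>Generic sets that decide all affine images of a given set\<close>

definition unsplit :: "'a set \<Rightarrow> 'a set \<Rightarrow> bool" where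
  "unsplit X Z \<longleftrightarrow> definable Z \<and> generic_set Z \<and>
    (\<forall>a b. \<not> generic_set (Z \<inter> (\<lambda>x. a * x + b) ` X) \<or> \<not> generic_set (Z - (\<lambda>x. a * x + b) ` X))"

text \<open>The affine images of \<open>X\<close> are instances of one formula with the parameters a
  and b. If they split every definable generic set into two generic halves,
  \<open>ladder_of_splitting\<close> would give this formula or its negation the order
  property.\<close>

lemma unsplit_exists:
  assumes X: "definable X" obtains Z where "unsplit X Z"
proof (rule ccontr)
  define Y where "Y y = (\<lambda>x. fst y * x + snd y) ` X" for y
  define \<G> where "\<G> = {Z. definable Z \<and> generic_set Z}"
  assume "\<not> thesis"
  with that have no: "\<not> unsplit X Z" for Z by blast
  have def_Y: "definable (Y y)" for y
    unfolding Y_def by (rule definable_over_affine_image[OF X])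
  have split: "\<exists>y. Z \<inter> Y y \<in> \<G> \<and> Z - Y y \<in> \<G>" if Z: "Z \<in> \<G>" for Z
  proof -
    obtain a b where "generic_set (Z \<inter> Y (a, b))" "generic_set (Z - Y (a, b))"
      using no[of Z] Z by (auto simp: unsplit_def \<G>_def Y_def)
    then show ?thesis
      using Z def_Y by (intro exI[of _ "(a, b)"])
        (auto simp: \<G>_def definable_over_Int definable_over_Diff)
  qed
  have mono: "Z \<inter> Y y \<in> \<G> \<and> Z - Y y \<in> \<G>"
    if "Z \<in> \<G>" "Z' \<in> \<G>" "Z' \<subseteq> Z" "Z' \<inter> Y y \<in> \<G>" "Z' - Y y \<in> \<G>" for Z Z' y
  proof -
    have "Z' \<inter> Y y \<subseteq> Z \<inter> Y y" "Z' - Y y \<subseteq> Z - Y y" using that(3) by auto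
    then show ?thesis
      using that def_Y generic_set_mono[of "Z' \<inter> Y y" "Z \<inter> Y y"] generic_set_mono[of "Z' - Y y" "Z - Y y"]
      by (simp add: \<G>_def definable_over_Int definable_over_Diff)
  qed
  have univ: "UNIV \<in> \<G>" by (simp add: \<G>_def generic_set_UNIV definable_over_UNIV)
  have ne: "Z \<noteq> {}" if "Z \<in> \<G>" for Z using that generic_set_nonempty by (auto simp: \<G>_def)
  obtain t and a :: "nat \<Rightarrow> 'a" and b
    where ab: "\<And>i j. (a i \<in> Y (b j) \<longleftrightarrow> t) \<longleftrightarrow> i < j"
    by (rule ladder_of_splitting[OF univ, of Y], erule ne, erule split, erule (4) mono, blast)
  have "definable_pred I UNIV (\<lambda>v. v 3 \<in> X \<and>
      eval_trm v (Var 0) = eval_trm v (Add (Mul (Var 1) (Var 3)) (Var 2)))"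
    by (intro definable_pred_conj definable_pred_mem definable_pred_eq X)
  from definable_pred_ex[OF this, of 3]
  have "definable_pred I UNIV (\<lambda>v. v 0 \<in> Y (v 1, v 2))"
    by (rule back_subst[where P = "definable_pred I UNIV"]) (auto simp: fun_eq_iff Y_def)
  then have "definable_pred I UNIV (\<lambda>v. v 0 \<in> Y (v 1, v 2) \<longleftrightarrow> t)"
    using definable_pred_not[of I UNIV "\<lambda>v. v 0 \<in> Y (v 1, v 2)"] by (cases t) simp_all
  then show False
    by (rule stable_no_ladder[OF stable,
          where a = a and b = "\<lambda>j k. if k = 1 then fst (b j) else snd (b j)"])
      (use ab in auto)
qed

lemma inj_affine: "(c :: 'a) \<noteq> 0 \<Longrightarrow> inj (\<lambda>x. c * x + d)"
  by (auto simp: inj_def)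

text \<open>Affine images of \<open>X\<close> pull back along affine bijections to affine images of
  \<open>X\<close>; this carries \<open>unsplit\<close> and \<open>equiv_mod\<close> from
  \<open>Z\<close> to its own affine images.\<close>

lemma affine_image_cancel:
  fixes c d :: 'a
  assumes "c \<noteq> 0" shows "(\<lambda>x. a * x + b) ` X = (\<lambda>x. c * x + d) ` (\<lambda>x. a / c * x + (b - d) / c) ` X"
proof -
  have "c * (a / c * x + (b - d) / c) + d = a * x + b" for x using assms by (simp add: distrib_left)
  then show ?thesis by (simp only: image_image)
qed

lemma affine_Int_iff:
  fixes c d :: 'a
  assumes "c \<noteq> 0"
  shows "generic_set ((\<lambda>x. c * x + d) ` Z \<inter> (\<lambda>x. a * x + b) ` X) \<longleftrightarrow>
    generic_set (Z \<inter> (\<lambda>x. a / c * x + (b - d) / c) ` X)"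
  unfolding affine_image_cancel[OF assms, of a b X d] image_Int[OF inj_affine[OF assms], symmetric]
  by (rule generic_set_affine_image[OF assms])

lemma affine_Diff_iff:
  fixes c d :: 'a
  assumes "c \<noteq> 0"
  shows "generic_set ((\<lambda>x. c * x + d) ` Z - (\<lambda>x. a * x + b) ` X) \<longleftrightarrow>
    generic_set (Z - (\<lambda>x. a / c * x + (b - d) / c) ` X)"
  unfolding affine_image_cancel[OF assms, of a b X d] image_set_diff[OF inj_affine[OF assms], symmetric]
  by (rule generic_set_affine_image[OF assms])

lemma unsplit_affine_image:
  fixes c d :: 'a
  assumes "unsplit X Z" "c \<noteq> 0" shows "unsplit X ((\<lambda>x. c * x + d) ` Z)"
  using assms by (simp add: unsplit_def definable_over_affine_image generic_set_affine_image
      affine_Int_iff affine_Diff_iff del: times_divide_eq_left)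

text \<open>
  An unsplit set decides every affine image of \<open>X\<close>, so it stands for a generic type restricted to
  these sets; equivalence is equality of the restricted types.
\<close>

definition equiv_mod :: "'a set \<Rightarrow> 'a set \<Rightarrow> 'a set \<Rightarrow> bool" where
  "equiv_mod X Z W \<longleftrightarrow>
    (\<forall>a b. generic_set (Z \<inter> (\<lambda>x. a * x + b) ` X) \<longleftrightarrow> generic_set (W \<inter> (\<lambda>x. a * x + b) ` X))"

lemma equiv_mod_affine_image:
  fixes c d :: 'a
  assumes "equiv_mod X Z W" "c \<noteq> 0"
  shows "equiv_mod X ((\<lambda>x. c * x + d) ` Z) ((\<lambda>x. c * x + d) ` W)"
  using assms by (simp add: equiv_mod_def affine_Int_iff del: times_divide_eq_left)

lemma equiv_mod_sym: "equiv_mod X Z W \<Longrightarrow> equiv_mod X W Z"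
  by (simp add: equiv_mod_def)

lemma equiv_mod_trans: "equiv_mod X Z W \<Longrightarrow> equiv_mod X W V \<Longrightarrow> equiv_mod X Z V"
  by (simp add: equiv_mod_def)

text \<open>The generic overlap is not the union of two non-generic pieces, so one of its parts
  inside and outside a given affine image is generic. \<open>Z\<close> and \<open>W\<close> inherit
  this and, being unsplit, decide the image alike.\<close>

lemma equiv_modI:
  assumes X: "definable X" and Z: "unsplit X Z" and W: "unsplit X W" and ZW: "generic_set (Z \<inter> W)"
  shows "equiv_mod X Z W"
  unfolding equiv_mod_def
proof (intro allI)
  fix a b
  define Y where "Y = (\<lambda>x. a * x + b) ` X"
  have Y: "definable Y" unfolding Y_def by (rule definable_over_affine_image[OF X])
  have def_ZW: "definable Z" "definable W" using Z W by (auto simp: unsplit_def)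
  have split: "Z \<inter> W \<inter> Y \<union> (Z \<inter> W - Y) = Z \<inter> W" by blast
  consider "generic_set (Z \<inter> W \<inter> Y)" | "generic_set (Z \<inter> W - Y)"
    using nongeneric_Un[of "Z \<inter> W \<inter> Y" "Z \<inter> W - Y"] Y def_ZW ZW
    by (auto simp: split definable_over_Int definable_over_Diff)
  then show "generic_set (Z \<inter> (\<lambda>x. a * x + b) ` X) \<longleftrightarrow> generic_set (W \<inter> (\<lambda>x. a * x + b) ` X)"
    unfolding Y_def[symmetric]
  proof cases
    case 1
    then show "generic_set (Z \<inter> Y) \<longleftrightarrow> generic_set (W \<inter> Y)"
      using generic_set_mono[of "Z \<inter> W \<inter> Y" "Z \<inter> Y"] generic_set_mono[of "Z \<inter> W \<inter> Y" "W \<inter> Y"] by auto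
  next
    case 2
    then have "generic_set (Z - Y)" "generic_set (W - Y)"
      using generic_set_mono[of "Z \<inter> W - Y"] by blast+
    then show "generic_set (Z \<inter> Y) \<longleftrightarrow> generic_set (W \<inter> Y)"
      using Z W unfolding unsplit_def Y_def by blast
  qed
qed

text \<open>
  Only finitely many translates of an unsplit set \<open>Z\<close> are inequivalent, so some nonzero \<open>s\<close>
  fixes the class of \<open>Z\<close>. Every affine image of \<open>Z\<close> is equivalent to a translate of \<open>Z\<close>, so
  the translations that fix the class of \<open>Z\<close> form an ideal.
\<close>

lemma unsplit_translate:
  assumes X: "definable X" and Z: "unsplit X Z"
  obtains F where "finite F" "\<And>W. unsplit X W \<Longrightarrow> \<exists>f\<in>F. equiv_mod X W ((\<lambda>x. 1 * x + f) ` Z)"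
    "(\<Union>f\<in>F. (\<lambda>x. 1 * x + f) ` Z) = UNIV"
proof -
  obtain F where F: "finite F" "\<And>x. \<exists>f\<in>F. x - f \<in> Z"
    using Z by (auto simp: unsplit_def generic_set_iff)
  have cover: "(\<Union>f\<in>F. (\<lambda>x. 1 * x + f) ` Z) = UNIV"
  proof (intro equalityI subsetI)
    fix x
    obtain f where "f \<in> F" "x - f \<in> Z" using F by blast
    then show "x \<in> (\<Union>f\<in>F. (\<lambda>x. 1 * x + f) ` Z)" by (auto intro!: bexI[of _ f] image_eqI[of _ _ "x - f"])
  qed simp
  have "\<exists>f\<in>F. equiv_mod X W ((\<lambda>x. 1 * x + f) ` Z)" if W: "unsplit X W" for W
  proof -
    have "(\<Union>f\<in>F. W \<inter> (\<lambda>x. 1 * x + f) ` Z) = W" using cover by auto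
    then obtain f where "f \<in> F" "generic_set (W \<inter> (\<lambda>x. 1 * x + f) ` Z)"
      using nongeneric_UN[of F "\<lambda>f. W \<inter> (\<lambda>x. 1 * x + f) ` Z"] F(1) W Z
      by (auto simp: unsplit_def intro!: definable_over_Int definable_over_affine_image[of _ _ 1, simplified])
    then show ?thesis
      using equiv_modI[OF X W unsplit_affine_image[OF Z, of 1 f]] by (intro bexI[of _ f]) simp_all
  qed
  with F(1) cover show ?thesis using that by blast
qed

lemma equiv_mod_translate:
  assumes X: "definable X" and Z: "unsplit X Z"
  shows "equiv_mod X ((\<lambda>x. 1 * x + s) ` Z) Z"
proof -
  obtain F where F: "finite F" "\<And>W. unsplit X W \<Longrightarrow> \<exists>f\<in>F. equiv_mod X W ((\<lambda>x. 1 * x + f) ` Z)"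
    using unsplit_translate[OF X Z] by metis
  have "\<exists>f\<in>F. equiv_mod X ((\<lambda>x. 1 * x + s) ` Z) ((\<lambda>x. 1 * x + f) ` Z)" for s
    by (rule F(2)[OF unsplit_affine_image[OF Z]]) simp
  then obtain h where h: "\<And>s. h s \<in> F" "\<And>s. equiv_mod X ((\<lambda>x. 1 * x + s) ` Z) ((\<lambda>x. 1 * x + h s) ` Z)"
    by metis
  \<comment> \<open>There are infinitely many translations and finitely many representatives, so Z +
    u and Z + v are equivalent for some u \<noteq> v, and u - v fixes the class of
    \<open>Z\<close>.\<close>
  have "\<not> inj h"
    using F(1) h(1) infinite_field by (metis finite_imageD finite_subset image_subsetI)
  then obtain u v where uv: "h u = h v" "u \<noteq> v" by (auto simp: inj_def)
  have "equiv_mod X ((\<lambda>x. 1 * x + u) ` Z) ((\<lambda>x. 1 * x + v) ` Z)"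
    using equiv_mod_trans[OF h(2)[of u], of "(\<lambda>x. 1 * x + v) ` Z"] equiv_mod_sym[OF h(2)[of v]]
    by (simp only: uv(1))
  from equiv_mod_affine_image[OF this, of 1 "- v"]
  have st: "equiv_mod X ((\<lambda>x. 1 * x + (u - v)) ` Z) Z" by (simp add: image_image add_diff_eq)
  show ?thesis
  proof (cases "s = 0")
    case True
    then show ?thesis by (simp add: equiv_mod_def)
  next
    case False
    define c where "c = s / (u - v)"
    have c: "c \<noteq> 0" "c * (u - v) = s" using False uv by (auto simp: c_def)
    \<comment> \<open>Z / c is equivalent to some Z + f, whose class is also fixed by u - v. Hence u
      - v fixes the class of Z / c, and multiplication by \<open>c\<close> shows that
      \<open>s\<close> fixes that of \<open>Z\<close>.\<close>
    define Z1 where "Z1 = (\<lambda>x. inverse c * x + 0) ` Z"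
    have Z1: "unsplit X Z1" unfolding Z1_def by (rule unsplit_affine_image[OF Z]) (use c in simp)
    obtain f where f: "equiv_mod X Z1 ((\<lambda>x. 1 * x + f) ` Z)" using F(2)[OF Z1] by blast
    have "equiv_mod X ((\<lambda>x. 1 * x + (u - v)) ` Z1) ((\<lambda>x. 1 * x + (u - v)) ` (\<lambda>x. 1 * x + f) ` Z)"
      by (rule equiv_mod_affine_image[OF f]) simp
    also have "(\<lambda>x. 1 * x + (u - v)) ` (\<lambda>x. 1 * x + f) ` Z = (\<lambda>x. 1 * x + f) ` (\<lambda>x. 1 * x + (u - v)) ` Z"
      by (simp add: image_image algebra_simps)
    finally have "equiv_mod X ((\<lambda>x. 1 * x + (u - v)) ` Z1) Z1"
      using equiv_mod_affine_image[OF st, of 1 f] f equiv_mod_sym equiv_mod_trans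
      by (metis zero_neq_one)
    from equiv_mod_affine_image[OF this, of c 0] c show ?thesis
      by (simp add: Z1_def image_image distrib_left right_diff_distrib mult.assoc[symmetric])
  qed
qed

text \<open>Finitely many translates of an unsplit \<open>Z\<close> cover the field, and being
  equivalent they decide \<open>X\<close> alike. The side of \<open>X\<close> that they reject is
  then a finite union of non-generic sets. Together with \<open>generic_or_Compl_generic\<close>
  this is uniqueness of the generic type.\<close>

lemma nongeneric_or_Compl_nongeneric:
  assumes X: "definable X" shows "\<not> generic_set X \<or> \<not> generic_set (- X)"
proof -
  obtain Z where Z: "unsplit X Z" using unsplit_exists[OF X] .
  obtain F where F: "finite F" "(\<Union>f\<in>F. (\<lambda>x. 1 * x + f) ` Z) = UNIV"
    using unsplit_translate[OF X Z] by metis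
  have same: "generic_set ((\<lambda>x. 1 * x + f) ` Z \<inter> X) \<longleftrightarrow> generic_set (Z \<inter> X)" for f
    using equiv_mod_translate[OF X Z, of f, unfolded equiv_mod_def, rule_format, of 1 0] by simp
  have uns: "\<not> generic_set ((\<lambda>x. 1 * x + f) ` Z \<inter> X) \<or> \<not> generic_set ((\<lambda>x. 1 * x + f) ` Z - X)" for f
    using unsplit_affine_image[OF Z, of 1 f, unfolded unsplit_def, THEN conjunct2, THEN conjunct2,
        rule_format, of 1 0] by simp
  have def_f: "definable ((\<lambda>x. 1 * x + f) ` Z)" for f
    using Z by (intro definable_over_affine_image) (simp add: unsplit_def)
  show ?thesis
  proof (cases "generic_set (Z \<inter> X)")
    case True
    have "\<not> generic_set (\<Union>f\<in>F. (\<lambda>x. 1 * x + f) ` Z - X)"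
      using True same uns by (intro nongeneric_UN F definable_over_Diff def_f X) blast
    moreover have "(\<Union>f\<in>F. (\<lambda>x. 1 * x + f) ` Z - X) = - X" using F(2) by auto
    ultimately show ?thesis by simp
  next
    case False
    have "\<not> generic_set (\<Union>f\<in>F. (\<lambda>x. 1 * x + f) ` Z \<inter> X)"
      using False same by (intro nongeneric_UN F definable_over_Int def_f X) blast
    moreover have "(\<Union>f\<in>F. (\<lambda>x. 1 * x + f) ` Z \<inter> X) = X" using F(2) by auto
    ultimately show ?thesis by simp
  qed
qed

section \<open>The field of non-generic elements\<close>

text \<open>This is the set \<open>N B\<close> of the overview.\<close>

definition nongenerics :: "'a set \<Rightarrow> 'a set" where
  "nongenerics B = {x. \<not> generic_over I B x}"

lemma nongenerics_iff:
  "x \<in> nongenerics B \<longleftrightarrow> (\<exists>X\<in>definable_over I B. x \<in> X \<and> \<not> generic_set X)"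
  by (auto simp: nongenerics_def generic_over_def tp_def definable_over_def)

lemma nongenerics_mono:
  assumes "B \<subseteq> C" shows "nongenerics B \<subseteq> nongenerics C"
proof
  fix x assume "x \<in> nongenerics B"
  then obtain X where "X \<in> definable_over I B" "x \<in> X \<and> \<not> generic_set X"
    by (auto simp: nongenerics_iff)
  then show "x \<in> nongenerics C"
    unfolding nongenerics_iff using definable_over_mono[OF assms] by (intro bexI[of _ X])
qed

lemma singleton_nongeneric: "\<not> generic_set {a :: 'a}"
proof
  assume "generic_set {a}"
  then obtain F where F: "finite F" "\<And>x. \<exists>f\<in>F. x - f \<in> {a}" by (auto simp only: generic_set_iff)
  have "UNIV \<subseteq> (+) a ` F"
  proof
    fix x
    obtain f where "f \<in> F" "x - f = a" using F(2) by blast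
    then show "x \<in> (+) a ` F" by (auto simp: diff_eq_eq)
  qed
  then show False using F(1) infinite_field by (metis finite_imageI finite_subset)
qed

lemma mem_nongenerics: "a \<in> B \<Longrightarrow> a \<in> nongenerics B"
  unfolding nongenerics_iff
  by (rule bexI[of _ "{a}"])
    (use singleton_nongeneric definable_pred_const[of a B I 0] in \<open>auto simp: definable_over_iff\<close>)

text \<open>Supplies 0, 1 and -1 even over the empty set: a closed term defines its value without
  parameters, and singletons are non-generic.\<close>

lemma closed_term_nongenerics:
  assumes "fv_trm t = {}" shows "eval_trm (\<lambda>_. 0) t \<in> nongenerics B"
proof -
  define c :: 'a where "c = eval_trm (\<lambda>_. 0) t"
  have "eval_trm v t = c" for v :: "nat \<Rightarrow> 'a"
    unfolding c_def using assms by (intro eval_trm_cong) auto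
  then have "definable_pred I B (\<lambda>v. v 0 = c)"
    using definable_pred_eq[of I B "Var 0" t] by simp
  then show ?thesis
    unfolding nongenerics_iff c_def[symmetric]
    by (intro bexI[of _ "{c}"]) (auto simp: definable_over_iff singleton_nongeneric)
qed

lemma definable_over_inverse:
  assumes "X \<in> definable_over I B" shows "{y. \<exists>d\<in>X. y * d = 1} \<in> definable_over I B"
proof -
  have "definable_pred I B (\<lambda>v. v 1 \<in> X \<and> eval_trm v (Mul (Var 0) (Var 1)) = eval_trm v One)"
    by (intro definable_pred_conj definable_pred_mem definable_pred_eq assms)
  from definable_pred_ex[OF this, of 1] show ?thesis
    by (simp add: definable_over_iff Bex_def)
qed

text \<open>
  If \<open>1/X\<close> were generic, then its complement would be nongeneric, and successive generic
  elements \<open>g i\<close> would satisfy \<open>g j / g i \<in> 1/X\<close> exactly for \<open>i < j\<close>.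
\<close>

lemma inverse_nongeneric:
  assumes X: "definable X" "\<not> generic_set X"
  shows "\<not> generic_set {y. \<exists>d\<in>X. y * d = 1}"
proof
  define E where "E = {y. \<exists>d\<in>X. y * d = 1}"
  assume "generic_set {y. \<exists>d\<in>X. y * d = 1}"
  have E: "definable E" unfolding E_def by (rule definable_over_inverse[OF X(1)])
  have nE: "\<not> generic_set (- E)"
    using nongeneric_or_Compl_nongeneric[OF E] \<open>generic_set _\<close> by (simp add: E_def)
  define Q where "Q F g \<longleftrightarrow> (\<forall>f\<in>F. g / f \<in> E \<and> f / g \<notin> E)" for F and g :: 'a
  have "\<exists>g. g \<noteq> 0 \<and> Q F g" if F: "finite F" "\<And>f. f \<in> F \<Longrightarrow> f \<noteq> 0" for F :: "'a set"
  proof -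
    \<comment> \<open>Outside f * (- E) the quotient g / f lies in \<open>E\<close>; outside f * X
      it is not in \<open>X\<close>, that is, f / g is not in \<open>E\<close>. Excluding 0 permits
      division, and \<open>insert 1 F\<close> keeps this effective when \<open>F\<close> is
      empty.\<close>
    define B where "B f = ((\<lambda>x. f * x + 0) ` (- E) \<union> (\<lambda>x. f * x + 0) ` X) \<union> {0}" for f
    have "definable {0 :: 'a}"
      using definable_pred_const[of 0 UNIV I 0] by (simp add: definable_over_iff)
    then have B: "definable (B f)" "\<not> generic_set (B f)" if "f \<in> insert 1 F" for f
    proof -
      have f: "f \<noteq> 0" using that F(2) by auto
      show "definable (B f)" unfolding B_def
        by (intro definable_over_Un definable_over_affine_image definable_over_Compl E X \<open>definable {0}\<close>)
      show "\<not> generic_set (B f)" unfolding B_def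
        by (intro nongeneric_Un definable_over_Un definable_over_affine_image definable_over_Compl
            E X \<open>definable {0}\<close>) (simp_all add: generic_set_affine_image[OF f] nE X singleton_nongeneric del: add_0_right)
    qed
    have "\<exists>g. \<forall>f\<in>insert 1 F. g \<notin> B f"
      by (rule nongeneric_UN_neq_UNIV) (use F(1) B in auto)
    then obtain g where g: "\<And>f. f \<in> insert 1 F \<Longrightarrow> g \<notin> B f" by blast
    have g0: "g \<noteq> 0" using g[of 1] by (auto simp: B_def)
    have "g / f \<in> E \<and> f / g \<notin> E" if f: "f \<in> F" for f
    proof -
      have f0: "f \<noteq> 0" using F f by blast
      then have eq: "f * (g / f) = g" by simp
      have "g / f \<in> E" using g[of f] f eq by (auto simp: B_def intro!: image_eqI[of _ _ "g / f"])
      moreover have "g / f \<notin> X" using g[of f] f eq by (auto simp: B_def intro!: image_eqI[of _ _ "g / f"])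
      then have "f / g \<notin> E" using f0 g0 by (auto simp: E_def field_simps)
      ultimately show ?thesis ..
    qed
    then show ?thesis using g0 by (auto simp: Q_def)
  qed
  then obtain g :: "nat \<Rightarrow> 'a" where g: "\<And>n. g n \<noteq> 0" "\<And>n. Q (g ` {..<n}) (g n)"
    using dependent_choice_history[of "\<lambda>g. g \<noteq> 0" Q] by metis
  have less: "g j / g i \<in> E" "g i / g j \<notin> E" if "i < j" for i j
    using g(2)[of j] that by (auto simp: Q_def)
  define R where "R x y \<longleftrightarrow> (\<exists>z. z \<in> E \<and> y = x * z)" for x y
  have R: "R (g i) (g j) \<longleftrightarrow> g j / g i \<in> E" for i j
    using g(1)[of i] by (auto simp: R_def intro!: exI[of _ "g j / g i"])
  have "definable_pred I UNIV (\<lambda>v. v 2 \<in> E \<and> eval_trm v (Var 1) = eval_trm v (Mul (Var 0) (Var 2)))"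
    by (intro definable_pred_conj definable_pred_mem definable_pred_eq E)
  from definable_pred_ex[OF this, of 2] have "definable_pred I UNIV (\<lambda>v. R (v 0) (v 1))"
    by (simp add: R_def)
  \<comment> \<open>Nothing is known about g i / g i; with odd indices on one side and even ones on
    the other, equal indices never meet.\<close>
  moreover have "R (g (Suc (2 * i))) (g (2 * j)) \<longleftrightarrow> i < j" for i j
  proof (cases "i < j")
    case True
    then show ?thesis using less(1)[of "Suc (2 * i)" "2 * j"] by (simp add: R)
  next
    case False
    then show ?thesis using less(2)[of "2 * j" "Suc (2 * i)"] by (simp add: R)
  qed
  ultimately show False by (rule no_ladder[of R "\<lambda>i. g (Suc (2 * i))" "\<lambda>j. g (2 * j)"])
qed

lemma inverse_nongenerics:
  assumes "x \<in> nongenerics B" shows "inverse x \<in> nongenerics B"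
proof (cases "x = 0")
  case True
  then show ?thesis using assms by simp
next
  case False
  obtain X where X: "X \<in> definable_over I B" "x \<in> X" "\<not> generic_set X"
    using assms by (auto simp: nongenerics_iff)
  moreover have "\<not> generic_set {y. \<exists>d\<in>X. y * d = 1}"
    using X by (intro inverse_nongeneric definable_over_mono[OF subset_UNIV])
  ultimately show ?thesis
    unfolding nongenerics_iff using definable_over_inverse[OF X(1)] False
    by (intro bexI[of _ "{y. \<exists>d\<in>X. y * d = 1}"]) (auto intro: bexI[of _ x])
qed

lemma generics_agree:
  assumes "X \<in> definable_over I B" "x \<in> X" "x \<notin> nongenerics B" "y \<notin> nongenerics B"
  shows "y \<in> X"
proof -
  have "generic_set X" using assms(1-3) by (auto simp: nongenerics_iff)
  then have "\<not> generic_set (- X)"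
    using nongeneric_or_Compl_nongeneric definable_over_mono[OF subset_UNIV assms(1)] by blast
  then show ?thesis using assms(4) definable_over_Compl[OF assms(1)] by (auto simp: nongenerics_iff)
qed

end

section \<open>Simple roots over a subfield\<close>

lemma subfield_closed:
  assumes "is_subfield L"
  shows "0 \<in> L" "1 \<in> L" "x \<in> L \<Longrightarrow> - x \<in> L" "x \<in> L \<Longrightarrow> inverse x \<in> L"
    "x \<in> L \<Longrightarrow> y \<in> L \<Longrightarrow> x + y \<in> L" "x \<in> L \<Longrightarrow> y \<in> L \<Longrightarrow> x * y \<in> L"
    "x \<in> L \<Longrightarrow> y \<in> L \<Longrightarrow> x - y \<in> L" "x \<in> L \<Longrightarrow> y \<in> L \<Longrightarrow> x / y \<in> L"
    "of_nat n \<in> L"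
proof -
  show *: "0 \<in> L" "1 \<in> L" "x \<in> L \<Longrightarrow> - x \<in> L" "x \<in> L \<Longrightarrow> inverse x \<in> L"
    "x \<in> L \<Longrightarrow> y \<in> L \<Longrightarrow> x + y \<in> L" "x \<in> L \<Longrightarrow> y \<in> L \<Longrightarrow> x * y \<in> L" for x y
    using assms by (simp_all add: is_subfield_def)
  show "x \<in> L \<Longrightarrow> y \<in> L \<Longrightarrow> x - y \<in> L" using *(5)[OF _ *(3), of x y] by simp
  show "x \<in> L \<Longrightarrow> y \<in> L \<Longrightarrow> x / y \<in> L" using *(6)[OF _ *(4), of x y] by (simp add: divide_inverse)
  show "of_nat n \<in> L" by (induction n) (simp_all add: *)
qed

definition coeffs_in :: "'a::zero set \<Rightarrow> 'a poly \<Rightarrow> bool" where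
  "coeffs_in L p \<longleftrightarrow> (\<forall>i. coeff p i \<in> L)"

text \<open>A condition on two values at \<open>x\<close>: unlike separability of the polynomial it
  is directly expressible by a formula about \<open>x\<close>, and it passes to every factor that
  vanishes at \<open>x\<close>.\<close>

definition simple_root :: "'a::field poly \<Rightarrow> 'a \<Rightarrow> bool" where
  "simple_root p x \<longleftrightarrow> poly p x = 0 \<and> poly (pderiv p) x \<noteq> 0"

lemma simple_root_nonzero: "simple_root p x \<Longrightarrow> p \<noteq> 0"
  by (auto simp: simple_root_def)

lemma separable_imp_simple_root:
  assumes "separable p" "poly p x = 0" shows "simple_root p x"
proof (rule ccontr)
  assume "\<not> simple_root p x"
  then have "[:- x, 1:] dvd p" "[:- x, 1:] dvd pderiv p"
    using assms(2) by (simp_all add: simple_root_def poly_eq_0_iff_dvd)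
  then have "is_unit [:- x, 1:]"
    using assms(1) unfolding separable_def by (rule coprime_common_divisor[rotated])
  then have "poly 1 x = 0" by (simp only: poly_eq_0_iff_dvd)
  then show False by simp
qed

lemma minimal_degree_dvd:
  fixes p q :: "'a::field poly"
  assumes L: "is_subfield L" and q: "coeffs_in L q" "q \<noteq> 0" "poly q x = 0"
    and min: "\<And>p. coeffs_in L p \<Longrightarrow> p \<noteq> 0 \<Longrightarrow> poly p x = 0 \<Longrightarrow> degree q \<le> degree p"
    and p: "coeffs_in L p" "poly p x = 0"
  shows "q dvd p"
  using p
proof (induction "degree p" arbitrary: p rule: less_induct)
  case less
  show ?case
  proof (cases "p = 0")
    case False
    have deg: "degree q \<le> degree p" using less.prems False min by blast
    \<comment> \<open>The leading term is cancelled by a multiple of \<open>q\<close> with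
      coefficients in \<open>L\<close>, so the induction hypothesis applies to what remains.\<close>
    define r where "r = monom (lead_coeff p / lead_coeff q) (degree p - degree q) * q"
    have "coeffs_in L (p - r)"
      using less.prems(1) q(1) L
      by (auto simp: coeffs_in_def r_def coeff_monom_mult subfield_closed)
    moreover have "poly (p - r) x = 0" using less.prems q by (simp add: r_def)
    moreover have "p - r = 0 \<or> degree (p - r) < degree p"
    proof (rule eq_zero_or_degree_less)
      have "degree r \<le> degree p"
        using deg degree_mult_le[of "monom (lead_coeff p / lead_coeff q) (degree p - degree q)" q]
          degree_monom_le[of "lead_coeff p / lead_coeff q" "degree p - degree q"]
        unfolding r_def by linarith
      then show "degree (p - r) \<le> degree p" by (simp add: degree_diff_le)
      show "coeff (p - r) (degree p) = 0"
        using deg q(2) by (simp add: r_def coeff_monom_mult)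
    qed
    ultimately have "q dvd p - r" using less.hyps by force
    moreover have "q dvd r" by (simp add: r_def)
    ultimately show ?thesis using dvd_add[of q "p - r" r] by simp
  qed simp
qed

lemma simple_root_minimal_degree:
  fixes f :: "'a::field poly"
  assumes L: "is_subfield L" and f: "coeffs_in L f" "simple_root f x"
  obtains q where "coeffs_in L q" "simple_root q x" "degree q \<le> degree f"
    "\<And>p. coeffs_in L p \<Longrightarrow> p \<noteq> 0 \<Longrightarrow> poly p x = 0 \<Longrightarrow> degree q \<le> degree p"
proof -
  define P where "P p \<longleftrightarrow> coeffs_in L p \<and> p \<noteq> 0 \<and> poly p x = 0" for p
  have "P f" using f simple_root_nonzero by (auto simp: P_def simple_root_def)
  then obtain q where q: "P q" "\<And>p. P p \<Longrightarrow> degree q \<le> degree p"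
    using arg_min_natI[of P f degree] arg_min_nat_le[of P _ degree] by metis
  then have min: "degree q \<le> degree p" if "coeffs_in L p" "p \<noteq> 0" "poly p x = 0" for p
    using that by (auto simp: P_def)
  have "q dvd f"
    by (rule minimal_degree_dvd[OF L _ _ _ min]) (use q(1) f in \<open>auto simp: P_def simple_root_def\<close>)
  then obtain r where "f = q * r" by blast
  \<comment> \<open>By the product rule the derivative of \<open>f\<close> at \<open>x\<close> is
    the product of \<open>poly (pderiv q) x\<close> and \<open>poly r x\<close>.\<close>
  then have "simple_root q x"
    using f(2) q(1) by (auto simp: P_def simple_root_def pderiv_mult)
  then show ?thesis using that[of q] q min \<open>P f\<close> by (auto simp: P_def)
qed

text \<open>Horner's scheme: h = c + X r gives h(X + g) = c + (X + g) r(X + g). The second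
  coefficient is affine in \<open>g\<close>, so a comparison of coefficients can be solved for
  \<open>g\<close>.\<close>

lemma coeff_pcompose_translate:
  fixes h :: "'a::comm_ring_1 poly"
  assumes "degree h \<le> Suc n"
  shows "coeff (pcompose h [:g, 1:]) (Suc n) = coeff h (Suc n) \<and>
    coeff (pcompose h [:g, 1:]) n = coeff h n + of_nat (Suc n) * g * coeff h (Suc n)"
  using assms
proof (induction n arbitrary: h)
  case (0 h)
  obtain c r where h: "h = pCons c r" by (cases h)
  with 0 have "degree r = 0" by (auto split: if_splits)
  then obtain d where "r = [:d:]" by (metis degree_eq_zeroE)
  then show ?case by (simp add: h pcompose_pCons)
next
  case (Suc n h)
  obtain c r where h: "h = pCons c r" by (cases h)
  with Suc.prems have r: "degree r \<le> Suc n" by (auto split: if_splits)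
  have "degree (pcompose r [:g, 1:]) \<le> Suc n"
    using degree_pcompose_le[of r "[:g, 1:]"] r by (simp split: if_splits)
  then have 0: "coeff (pcompose r [:g, 1:]) (Suc (Suc n)) = 0" by (simp add: coeff_eq_0)
  have "coeff (pcompose h [:g, 1:]) (Suc k) =
      g * coeff (pcompose r [:g, 1:]) (Suc k) + coeff (pcompose r [:g, 1:]) k" for k
    by (simp add: h pcompose_pCons)
  then show ?case using Suc.IH[OF r] 0 by (simp add: h algebra_simps)
qed

lemma coeffs_in_pcompose_linear:
  assumes L: "is_subfield L" and "coeffs_in L h" "a \<in> L" "b \<in> L"
  shows "coeffs_in L (pcompose h [:a, b:])"
  using assms(2)
proof (induction h)
  case (pCons c h)
  have "coeff (pCons c h) (Suc i) \<in> L" for i using pCons.prems unfolding coeffs_in_def by blast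
  then have "coeffs_in L (pcompose h [:a, b:])" "c \<in> L"
    using pCons.IH pCons.prems unfolding coeffs_in_def by (auto dest: spec[of _ 0])
  then show ?case
    using assms(3,4) L
    by (auto simp: coeffs_in_def pcompose_pCons coeff_pCons subfield_closed split: nat.splits)
qed (simp add: coeffs_in_def subfield_closed[OF L])

text \<open>
  Over \<open>L'\<close> the element \<open>x\<close> has the same minimal polynomial \<open>q\<close> of degree \<open>n\<close> as over \<open>L\<close>.
  Comparing \<open>q\<close> with polynomials for \<open>x + g\<close> and \<open>x * g\<close> forces \<open>n * g \<in> L\<close>, hence \<open>n = 0\<close> in
  the field, and \<open>q = c * X ^ n + d\<close>; so \<open>q\<close> has derivative zero.
\<close>

lemma no_uniform_degree:
  fixes x g :: "'a::field"
  assumes L: "is_subfield L" and L': "is_subfield L'" "L \<subseteq> L'" and g: "g \<in> L'" "g \<notin> L"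
    and minx: "\<And>p. coeffs_in L' p \<Longrightarrow> p \<noteq> 0 \<Longrightarrow> poly p x = 0 \<Longrightarrow> n \<le> degree p"
    and ming: "\<And>p. coeffs_in L p \<Longrightarrow> p \<noteq> 0 \<Longrightarrow> poly p g = 0 \<Longrightarrow> n \<le> degree p"
    and q: "coeffs_in L q" "degree q \<le> n" "simple_root q x"
    and h: "coeffs_in L h" "h \<noteq> 0" "degree h \<le> n" "poly h (x + g) = 0"
    and k: "coeffs_in L k" "k \<noteq> 0" "degree k \<le> n" "poly k (x * g) = 0"
  shows False
proof -
  have g0: "g \<noteq> 0" using g subfield_closed(1)[OF L] by auto
  have sub: "coeffs_in L' p" if "coeffs_in L p" for p using that L'(2) by (auto simp: coeffs_in_def)
  have q0: "q \<noteq> 0" "poly q x = 0" using q(3) simple_root_nonzero by (auto simp: simple_root_def)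
  have degq: "degree q = n" using minx[OF sub[OF q(1)]] q0 q(2) by simp
  have lq: "coeff q n \<noteq> 0" using q0(1) degq by (metis leading_coeff_0_iff)
  have n: "n \<noteq> 0"
  proof
    assume "n = 0"
    with degq obtain c where "q = [:c:]" by (metis degree_eq_zeroE)
    then show False using q(3) by (simp add: simple_root_def pderiv_pCons)
  qed
  \<comment> \<open>Minimality makes \<open>q\<close> unique up to a scalar factor; this is applied
    to h(X + g) and k(g X), which vanish at \<open>x\<close>.\<close>
  have multiple: "degree p = n \<and> p = smult (lead_coeff p / lead_coeff q) q"
    if p: "coeffs_in L' p" "p \<noteq> 0" "poly p x = 0" "degree p \<le> n" for p
  proof -
    have deg: "degree p = n" by (rule le_antisym[OF p(4) minx[OF p(1-3)]])
    define r where "r = p - smult (lead_coeff p / lead_coeff q) q"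
    have "coeffs_in L' r" using p(1) sub[OF q(1)] L'(1)
      by (auto simp: r_def coeffs_in_def subfield_closed)
    moreover have "poly r x = 0" using p(3) q0(2) by (simp add: r_def)
    moreover have "r = 0 \<or> degree r < n"
      unfolding r_def
    proof (intro eq_zero_or_degree_less degree_diff_le)
      show "coeff (p - smult (lead_coeff p / lead_coeff q) q) n = 0"
        using deg degq lq by simp
    qed (use deg degq degree_smult_le[of "lead_coeff p / lead_coeff q" q] in auto)
    ultimately have "r = 0" using minx[of r] by linarith
    then show ?thesis using deg by (simp add: r_def)
  qed
  have "of_nat n = (0 :: 'a)"
  proof (rule ccontr)
    assume nz: "of_nat n \<noteq> (0 :: 'a)"
    define H where "H = pcompose h [:g, 1:]"
    have "coeffs_in L' H" unfolding H_def
      by (intro coeffs_in_pcompose_linear sub h L' g subfield_closed(2))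
    moreover have "H \<noteq> 0" using h(2) pcompose_eq_0[of h "[:g, 1:]"] by (auto simp: H_def)
    moreover have "poly H x = 0" using h(4) by (simp add: H_def poly_pcompose add.commute)
    moreover have degH: "degree H = degree h" by (simp add: H_def degree_pcompose)
    ultimately have H: "degree h = n" "H = smult (lead_coeff H / lead_coeff q) q"
      using multiple[of H] h(3) by auto
    obtain j where j: "n = Suc j" using n by (cases n) auto
    have c: "coeff H n = coeff h n" "coeff H j = coeff h j + of_nat n * g * coeff h n"
      using coeff_pcompose_translate[of h j g] H(1) by (simp_all add: H_def j)
    have inL: "coeff h i \<in> L" "coeff q i \<in> L" for i using h(1) q(1) by (auto simp: coeffs_in_def)
    have hn: "coeff h n \<noteq> 0" using H(1) h(2) by auto
    have "coeff H j = coeff h n / coeff q n * coeff q j"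
      using arg_cong[OF H(2), of "\<lambda>p. coeff p j"] degH H(1) degq c(1) by simp
    then have "g = (coeff h n / coeff q n * coeff q j - coeff h j) / (of_nat n * coeff h n)"
      using nz hn c(2) by (simp add: field_simps)
    also have "\<dots> \<in> L" using L inL by (simp add: subfield_closed)
    finally show False using g by simp
  qed
  moreover have "coeff q i = 0" if i: "0 < i" "i < n" for i
  proof (rule ccontr)
    assume qi: "coeff q i \<noteq> 0"
    define H where "H = pcompose k [:0, g:]"
    have "coeffs_in L' H" unfolding H_def
      by (intro coeffs_in_pcompose_linear sub k L' g subfield_closed(1))
    moreover have "H \<noteq> 0" using k(2) g0 pcompose_eq_0[of k "[:0, g:]"] by (auto simp: H_def)
    moreover have "poly H x = 0" using k(4) by (simp add: H_def poly_pcompose)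
    moreover have degH: "degree H = degree k" using g0 by (simp add: H_def degree_pcompose)
    ultimately have H: "degree k = n" "H = smult (lead_coeff H / lead_coeff q) q"
      using multiple[of H] k(3) by auto
    have c: "coeff H j = g ^ j * coeff k j" for j
      by (simp add: H_def coeff_pcompose_linear)
    have inL: "coeff k i \<in> L" "coeff q i \<in> L" for i using k(1) q(1) by (auto simp: coeffs_in_def)
    define d where "d = coeff k n / coeff q n * coeff q i"
    have d: "d \<noteq> 0" "d \<in> L"
      using H(1) k(2) lq qi L inL by (auto simp: d_def subfield_closed)
    have "g ^ i * coeff k i = g ^ n * d"
      using arg_cong[OF H(2), of "\<lambda>p. coeff p i"] degH H(1) degq c by (simp add: d_def)
    also have "g ^ n = g ^ i * g ^ (n - i)" using i by (simp flip: power_add)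
    finally have gi: "coeff k i = g ^ (n - i) * d" using g0 by simp
    \<comment> \<open>The coefficients at i show that g^(n - i) lies in \<open>L\<close>, so
      \<open>g\<close> is a root of a polynomial over \<open>L\<close> of degree less than
      \<open>n\<close>, against \<open>ming\<close>.\<close>
    define p where "p = monom d (n - i) - [:coeff k i:]"
    have "coeffs_in L p" using d inL L by (auto simp: coeffs_in_def p_def coeff_pCons subfield_closed split: nat.splits)
    moreover have "coeff p (n - i) = d" using i by (simp add: p_def coeff_pCons split: nat.splits)
    then have "p \<noteq> 0" using d by auto
    moreover have "poly p g = 0" by (simp add: p_def poly_monom gi mult.commute)
    ultimately have "n \<le> degree p" by (rule ming)
    moreover have "degree p \<le> n - i"
      unfolding p_def by (intro degree_diff_le degree_monom_le) simp
    ultimately show False using i by linarith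
  qed
  ultimately have "coeff (pderiv q) j = 0" for j
    using degq by (cases "Suc j" n rule: linorder_cases) (auto simp: coeff_pderiv coeff_eq_0 simp del: of_nat_Suc)
  then have "pderiv q = 0" by (simp add: poly_eq_iff)
  then show False using q(3) by (simp add: simple_root_def)
qed

section \<open>Transfer between generic elements\<close>

context infinite_stable_field
begin

text \<open>A formula cannot quantify over polynomials. For f = c + X r one has f(x) = c + x r(x)
  and f'(x) = r(x) + x r'(x), so the induction on \<open>n\<close> carries value and derivative as a
  pair.\<close>

lemma definable_poly_values:
  assumes D: "D \<in> definable_over I B" "0 \<in> D"
  shows "definable_pred I B (\<lambda>v. \<exists>f. coeffs_in D f \<and> degree f \<le> n \<and>
    poly f (v 0) = v 1 \<and> poly (pderiv f) (v 0) = v 2)"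
proof (induction n)
  case 0
  have "definable_pred I B (\<lambda>v. v 1 \<in> D \<and> eval_trm v (Var 2) = eval_trm v Zero)"
    by (intro definable_pred_conj definable_pred_mem definable_pred_eq D)
  moreover have "v 1 \<in> D \<and> v 2 = 0 \<longleftrightarrow> (\<exists>f. coeffs_in D f \<and> degree f \<le> 0 \<and>
      poly f (v 0) = v 1 \<and> poly (pderiv f) (v 0) = v 2)" for v :: "nat \<Rightarrow> 'a"
  proof
    assume "v 1 \<in> D \<and> v 2 = 0"
    then show "\<exists>f. coeffs_in D f \<and> degree f \<le> 0 \<and> poly f (v 0) = v 1 \<and> poly (pderiv f) (v 0) = v 2"
      using D(2) by (intro exI[of _ "[:v 1:]"])
        (auto simp: coeffs_in_def coeff_pCons pderiv_pCons split: nat.splits)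
  next
    assume "\<exists>f. coeffs_in D f \<and> degree f \<le> 0 \<and> poly f (v 0) = v 1 \<and> poly (pderiv f) (v 0) = v 2"
    then obtain f where f: "coeffs_in D f" "degree f \<le> 0" "poly f (v 0) = v 1" "poly (pderiv f) (v 0) = v 2"
      by blast
    obtain c where "f = [:c:]" using f(2) degree_eq_zeroE[of f] by auto
    then show "v 1 \<in> D \<and> v 2 = 0"
      using f by (auto simp: coeffs_in_def pderiv_pCons dest: spec[of _ 0])
  qed
  ultimately show ?case by simp
next
  case (Suc n)
  define P where "P n v \<longleftrightarrow> (\<exists>f. coeffs_in D f \<and> degree f \<le> n \<and>
      poly f (v 0) = v 1 \<and> poly (pderiv f) (v 0) = v 2)" for n and v :: "nat \<Rightarrow> 'a"
  have "inj (id(1 := 4, 4 := 1, 2 := 5, 5 := 2 :: nat))" by (auto simp: inj_def split: if_splits)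
  note ren = definable_pred_rename[OF Suc.IH[folded P_def] this]
  have "definable_pred I B (\<lambda>v. v 3 \<in> D \<and> P n (v \<circ> id(1 := 4, 4 := 1, 2 := 5, 5 := 2)) \<and>
      eval_trm v (Var 1) = eval_trm v (Add (Var 3) (Mul (Var 0) (Var 4))) \<and>
      eval_trm v (Var 2) = eval_trm v (Add (Var 4) (Mul (Var 0) (Var 5))))"
    by (intro definable_pred_conj definable_pred_mem definable_pred_eq D ren)
  from definable_pred_ex[OF definable_pred_ex[OF definable_pred_ex[OF this, of 5], of 4], of 3]
  have "definable_pred I B (\<lambda>v. \<exists>c u w. c \<in> D \<and>
      (\<exists>f. coeffs_in D f \<and> degree f \<le> n \<and> poly f (v 0) = u \<and> poly (pderiv f) (v 0) = w) \<and>
      v 1 = c + v 0 * u \<and> v 2 = u + v 0 * w)"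
    by (simp add: P_def)
  moreover have "(\<exists>c u w. c \<in> D \<and>
      (\<exists>f. coeffs_in D f \<and> degree f \<le> n \<and> poly f (v 0) = u \<and> poly (pderiv f) (v 0) = w) \<and>
      v 1 = c + v 0 * u \<and> v 2 = u + v 0 * w) \<longleftrightarrow> P (Suc n) v" for v
  proof
    assume "\<exists>c u w. c \<in> D \<and>
      (\<exists>f. coeffs_in D f \<and> degree f \<le> n \<and> poly f (v 0) = u \<and> poly (pderiv f) (v 0) = w) \<and>
      v 1 = c + v 0 * u \<and> v 2 = u + v 0 * w"
    then obtain c f where "c \<in> D" "coeffs_in D f" "degree f \<le> n" "v 1 = c + v 0 * poly f (v 0)"
      "v 2 = poly f (v 0) + v 0 * poly (pderiv f) (v 0)" by blast
    then show "P (Suc n) v"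
      unfolding P_def by (intro exI[of _ "pCons c f"])
        (auto simp: coeffs_in_def coeff_pCons pderiv_pCons split: nat.splits)
  next
    assume "P (Suc n) v"
    then obtain f where f: "coeffs_in D f" "degree f \<le> Suc n" "poly f (v 0) = v 1"
      "poly (pderiv f) (v 0) = v 2" unfolding P_def by blast
    obtain c r where r: "f = pCons c r" by (cases f)
    have cr: "c \<in> D" "coeffs_in D r"
      using f(1) unfolding r coeffs_in_def by (metis coeff_pCons_0, metis coeff_pCons_Suc)
    moreover have "degree r \<le> n" using f(2) by (auto simp: r split: if_splits)
    ultimately show "\<exists>c u w. c \<in> D \<and>
      (\<exists>f. coeffs_in D f \<and> degree f \<le> n \<and> poly f (v 0) = u \<and> poly (pderiv f) (v 0) = w) \<and>
      v 1 = c + v 0 * u \<and> v 2 = u + v 0 * w"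
      using f(3,4) by (intro exI[of _ c] exI[of _ "poly r (v 0)"] exI[of _ "poly (pderiv r) (v 0)"])
        (auto simp: r pderiv_pCons)
  qed
  ultimately show ?case by (simp add: P_def)
qed

text \<open>The coefficients of \<open>f\<close> need not belong to \<open>B\<close>, so the type of
  \<open>x\<close> over \<open>B\<close> cannot mention them. It can mention a non-generic set
  \<open>D\<close>, definable over \<open>B\<close>, that contains them all; any polynomial with
  coefficients in \<open>D\<close> again has non-generic coefficients.\<close>

lemma generic_simple_root_transfer:
  assumes f: "coeffs_in (nongenerics B) f" "simple_root f x"
    and x: "x \<notin> nongenerics B" and y: "y \<notin> nongenerics B"
  obtains p where "coeffs_in (nongenerics B) p" "degree p \<le> degree f" "simple_root p y"
proof -
  have "\<forall>i. \<exists>X\<in>definable_over I B. coeff f i \<in> X \<and> \<not> generic_set X"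
    using f(1) by (auto simp: coeffs_in_def nongenerics_iff)
  then obtain X where X: "\<And>i. X i \<in> definable_over I B" "\<And>i. coeff f i \<in> X i" "\<And>i. \<not> generic_set (X i)"
    by metis
  \<comment> \<open>The index one above the degree contributes a set that contains 0, the value of
    all higher coefficients.\<close>
  define D where "D = (\<Union>i\<in>{..Suc (degree f)}. X i)"
  have D: "D \<in> definable_over I B" unfolding D_def using X by (intro definable_over_UN) auto
  have nD: "\<not> generic_set D"
    unfolding D_def using X by (intro nongeneric_UN definable_over_mono[OF subset_UNIV]) auto
  have "0 = coeff f (Suc (degree f))" by (simp add: coeff_eq_0)
  then have "0 \<in> D" using X(2)[of "Suc (degree f)"] unfolding D_def by auto
  have fD: "coeff f i \<in> D" for i
  proof (cases "i \<le> degree f")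
    case True
    then show ?thesis using X(2)[of i] by (auto simp: D_def)
  next
    case False
    then show ?thesis using \<open>0 \<in> D\<close> by (simp add: coeff_eq_0)
  qed
  define S where "S = {x. \<exists>p. coeffs_in D p \<and> degree p \<le> degree f \<and> simple_root p x}"
  have "definable_pred I B (\<lambda>v. (\<exists>p. coeffs_in D p \<and> degree p \<le> degree f \<and>
      poly p (v 0) = v 1 \<and> poly (pderiv p) (v 0) = v 2) \<and>
      eval_trm v (Var 1) = eval_trm v Zero \<and> \<not> eval_trm v (Var 2) = eval_trm v Zero)"
    by (intro definable_pred_conj definable_pred_not definable_pred_eq definable_poly_values D \<open>0 \<in> D\<close>)
  from definable_pred_ex[OF definable_pred_ex[OF this, of 2], of 1]
  have "S \<in> definable_over I B"
    unfolding definable_over_iff S_def simple_root_def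
    by (rule back_subst[where P = "definable_pred I B"]) (auto simp: fun_eq_iff)
  moreover have "x \<in> S" using f(2) fD by (auto simp: S_def coeffs_in_def)
  ultimately have "y \<in> S" using generics_agree x y by blast
  then obtain p where "coeffs_in D p" "degree p \<le> degree f" "simple_root p y" by (auto simp: S_def)
  moreover have "D \<subseteq> nongenerics B" using D nD by (auto simp: nongenerics_iff)
  ultimately show ?thesis using that[of p] by (auto simp: coeffs_in_def)
qed

text \<open>Avoiding all non-generic sets definable over \<open>B\<close> is finitely satisfiable,
  as finitely many of them do not cover the field; saturation does the rest.\<close>

lemma generic_exists:
  assumes "saturated \<kappa> I" "small \<kappa> B" obtains x where "x \<notin> nongenerics B"
proof -
  define \<Psi> where "\<Psi> = {\<psi> \<in> formulas_over B. \<not> generic_set (defset I \<psi>)}"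
  define neg where "neg \<psi> = (fm.Not (fst \<psi>), snd \<psi>)" for \<psi> :: "'r fm \<times> (nat \<Rightarrow> 'a)"
  have neg: "defset I (neg \<psi>) = - defset I \<psi>" for \<psi>
    by (cases \<psi>) (auto simp: neg_def defset_def)
  have "neg ` \<Psi> \<subseteq> formulas_over B"
    by (auto simp: \<Psi>_def neg_def formulas_over_def)
  moreover have "\<exists>x. \<forall>\<psi>\<in>\<Phi>. x \<in> defset I \<psi>" if \<Phi>: "\<Phi> \<subseteq> neg ` \<Psi>" "finite \<Phi>" for \<Phi>
  proof -
    obtain \<Psi>' where \<Psi>': "\<Psi>' \<subseteq> \<Psi>" "finite \<Psi>'" "\<Phi> = neg ` \<Psi>'"
      using finite_subset_image[OF \<Phi>(2,1)] by blast
    have "definable (defset I \<psi>)" if "\<psi> \<in> \<Psi>" for \<psi>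
      using that definable_over_mono[OF subset_UNIV, of "defset I \<psi>" I B]
      by (auto simp: \<Psi>_def definable_over_def)
    then have "\<exists>x. \<forall>\<psi>\<in>\<Psi>'. x \<notin> defset I \<psi>"
      using \<Psi>' by (intro nongeneric_UN_neq_UNIV) (auto simp: \<Psi>_def)
    then show ?thesis by (simp add: \<Psi>'(3) neg)
  qed
  ultimately obtain x where x: "\<forall>\<psi>\<in>neg ` \<Psi>. x \<in> defset I \<psi>"
    using assms unfolding saturated_def by meson
  have "x \<notin> nongenerics B"
    using x by (auto simp: nongenerics_iff definable_over_def \<Psi>_def neg)
  then show ?thesis using that by blast
qed

end

section \<open>Cardinality of parameter sets and the minimal degree argument\<close>

lemma infinite_formulas: "infinite (UNIV :: 'r fm set)"
proof -
  have "inj (\<lambda>n. fm.Eq (Var n) (Var n) :: 'r fm)" by (auto simp: inj_def)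
  then show ?thesis using infinite_UNIV_nat finite_imageD finite_subset subset_UNIV by metis
qed

text \<open>\<open>\<kappa>\<close> exceeds the infinite number of formulas, hence is infinite and
  absorbs one more parameter.\<close>

lemma small_insert:
  fixes I :: "'r \<Rightarrow> 'a::field list \<Rightarrow> bool" and \<kappa> :: "'k rel"
  assumes "monster \<kappa> I" "small \<kappa> B" shows "small \<kappa> (insert a B)"
proof -
  have \<kappa>: "Card_order \<kappa>" "|UNIV :: 'r fm set| <o \<kappa>" using assms(1) by (auto simp: monster_def)
  have "|UNIV :: 'r fm set| \<le>o |Field \<kappa>|"
    using \<kappa> ordLess_imp_ordLeq ordLeq_ordIso_trans card_of_Field_ordIso ordIso_symmetric by blast
  then have "infinite (Field \<kappa>)" using card_of_ordLeq_infinite infinite_formulas by blast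
  moreover have "|{a}| <o \<kappa>"
    using \<kappa>(1) calculation
    by (intro finite_ordLess_infinite card_of_Well_order card_order_on_well_order_on)
      (auto simp: Field_card_of)
  ultimately have "|{a} \<union> B| <o \<kappa>"
    using \<kappa>(1) assms(2) card_of_Un_ordLess_infinite_Field unfolding small_def by blast
  then show ?thesis by (simp add: small_def)
qed

theorem lemma2p3:
  fixes I :: "'r \<Rightarrow> 'a::field list \<Rightarrow> bool"
    and \<kappa> :: "'k rel"
    and A :: "'a set"
    and m :: nat
    and g :: 'a
    and h :: "nat \<Rightarrow> 'a"
  assumes "infinite (UNIV :: 'a set)"
    and "stable_theory I"
    and "monster \<kappa> I"
    and "\<forall>B x y. small \<kappa> B \<longrightarrow> \<not> generic_over I B x \<longrightarrow> \<not> generic_over I B y \<longrightarrow>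
           \<not> generic_over I B (x + y) \<and> \<not> generic_over I B (x * y)"
    and "small \<kappa> A"
    and "m \<ge> 1"
    and "generic_over I A g"
    and "separably_algebraic_over g (subfield_gen (A \<union> h ` {1..m}))"
  shows "\<exists>i\<in>{1..m}. generic_over I A (h i)"
proof (rule ccontr)
  assume no: "\<not> (\<exists>i\<in>{1..m}. generic_over I A (h i))"
  interpret infinite_stable_field I
    using assms(1,2) by unfold_locales
  have subfield: "is_subfield (nongenerics B)" if B: "small \<kappa> B" for B
  proof -
    have 1: "0 \<in> nongenerics B" "1 \<in> nongenerics B" "- 1 \<in> nongenerics B"
      using closed_term_nongenerics[of Zero B] closed_term_nongenerics[of One B]
        closed_term_nongenerics[of "Neg One" B] by simp_all
    have 2: "x + y \<in> nongenerics B" "x * y \<in> nongenerics B"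
      if "x \<in> nongenerics B" "y \<in> nongenerics B" for x y
      using that assms(4) B by (auto simp: nongenerics_def)
    have "- x \<in> nongenerics B" if "x \<in> nongenerics B" for x
      using 2(2)[OF 1(3) that] by simp
    then show ?thesis using 1 2 inverse_nongenerics by (auto simp: is_subfield_def)
  qed
  have proper: "\<exists>x. x \<notin> nongenerics B" if "small \<kappa> B" for B
    using generic_exists assms(3) that by (metis monster_def)
  define P where "P n \<longleftrightarrow> (\<exists>B. small \<kappa> B \<and> (\<forall>y. y \<notin> nongenerics B \<longrightarrow>
      (\<exists>p. coeffs_in (nongenerics B) p \<and> degree p \<le> n \<and> simple_root p y)))" for n
  have P: "P (degree f)" if "small \<kappa> B" "coeffs_in (nongenerics B) f" "simple_root f x"
    "x \<notin> nongenerics B" for B f x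
    unfolding P_def using that generic_simple_root_transfer by metis
  have "subfield_gen (A \<union> h ` {1..m}) \<subseteq> nongenerics A"
    unfolding subfield_gen_def
    using subfield[OF assms(5)] mem_nongenerics no by (intro Inter_lower) (auto simp: nongenerics_def)
  then obtain f where "coeffs_in (nongenerics A) f" "simple_root f g"
    using assms(8) separable_imp_simple_root
    unfolding separably_algebraic_over_def coeffs_in_def by blast
  then have "P (degree f)" using P assms(5,7) by (auto simp: nongenerics_def)
  define n where "n = (LEAST n. P n)"
  have least: "P n" "\<And>k. P k \<Longrightarrow> n \<le> k"
    unfolding n_def using \<open>P (degree f)\<close> by (auto intro: LeastI Least_le)
  then obtain B where B: "small \<kappa> B" and root: "\<And>y. y \<notin> nongenerics B \<Longrightarrow>
      \<exists>p. coeffs_in (nongenerics B) p \<and> degree p \<le> n \<and> simple_root p y"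
    unfolding P_def by blast
  \<comment> \<open>A smaller degree for one generic over \<open>C\<close> would pass, through a
    polynomial of minimal degree and transfer, to all generics over \<open>C\<close>, and
    \<open>P\<close> would hold below \<open>n\<close>.\<close>
  have minimal: "n \<le> degree p"
    if C: "small \<kappa> C" "B \<subseteq> C" "x \<notin> nongenerics C"
      and p: "coeffs_in (nongenerics C) p" "p \<noteq> 0" "poly p x = 0" for C x p
  proof -
    have sub: "nongenerics B \<subseteq> nongenerics C" using C(2) by (rule nongenerics_mono)
    then obtain f where "coeffs_in (nongenerics C) f" "simple_root f x"
      using root[of x] C(3) by (auto simp: coeffs_in_def)
    then obtain q where q: "coeffs_in (nongenerics C) q" "simple_root q x"
      "\<And>p. coeffs_in (nongenerics C) p \<Longrightarrow> p \<noteq> 0 \<Longrightarrow> poly p x = 0 \<Longrightarrow> degree q \<le> degree p"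
      using simple_root_minimal_degree[OF subfield[OF C(1)]] by metis
    have "n \<le> degree q" using least(2) P[OF C(1) q(1,2) C(3)] by blast
    also have "\<dots> \<le> degree p" using q(3) p by blast
    finally show ?thesis .
  qed
  \<comment> \<open>From here on \<open>g\<close> is a new element, generic over the optimal
    \<open>B\<close>; the original one entered through the bound \<open>degree f\<close>.\<close>
  obtain g where g: "g \<notin> nongenerics B" using proper[OF B] by blast
  define C where "C = insert g B"
  have C: "small \<kappa> C" "B \<subseteq> C" "g \<in> nongenerics C"
    using small_insert[OF assms(3) B] mem_nongenerics by (auto simp: C_def)
  obtain x where x: "x \<notin> nongenerics C" using proper[OF C(1)] by blast
  note L = subfield[OF B] and L' = subfield[OF C(1)]
  have sub: "nongenerics B \<subseteq> nongenerics C" using C(2) by (rule nongenerics_mono)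
  have "g \<noteq> 0" using g subfield_closed(1)[OF L] by auto
  \<comment> \<open>\<open>nongenerics C\<close> contains \<open>g\<close>, which is nonzero, so it
    would contain \<open>x\<close> along with either of these elements.\<close>
  then have "x + g \<notin> nongenerics C" "x * g \<notin> nongenerics C"
    using x C(3) subfield_closed(7)[OF L', of "x + g" g] subfield_closed(8)[OF L', of "x * g" g] by auto
  then have "x \<notin> nongenerics B" "x + g \<notin> nongenerics B" "x * g \<notin> nongenerics B"
    using x sub by auto
  note xs = this
  obtain q where q: "coeffs_in (nongenerics B) q" "degree q \<le> n" "simple_root q x"
    using root[OF xs(1)] by blast
  obtain u where u: "coeffs_in (nongenerics B) u" "degree u \<le> n" "simple_root u (x + g)"
    using root[OF xs(2)] by blast
  obtain w where w: "coeffs_in (nongenerics B) w" "degree w \<le> n" "simple_root w (x * g)"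
    using root[OF xs(3)] by blast
  have roots: "u \<noteq> 0" "w \<noteq> 0" "poly u (x + g) = 0" "poly w (x * g) = 0"
    using u(3) w(3) simple_root_nonzero by (auto simp: simple_root_def)
  show False
  proof (rule no_uniform_degree[OF L L' sub C(3) g])
    show "n \<le> degree p" if "coeffs_in (nongenerics C) p" "p \<noteq> 0" "poly p x = 0" for p
      using minimal[OF C(1,2) x that] .
    show "n \<le> degree p" if "coeffs_in (nongenerics B) p" "p \<noteq> 0" "poly p g = 0" for p
      using minimal[OF B subset_refl g that] .
  qed (fact q u w roots)+
qed

end
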